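(* Let $\mathcal{K},c,r>0$, let $M\ge1$ be an integer, let $k_c\in(0,1]$ and $c_1=k_c c$, let $t_0<T$, and let $m_0$ be a continuously differentiable probability density on $\mathbb{R}$. For $\gamma\ge0$ set $w(r;\gamma)=\frac{1-e^{-\gamma r}}{\gamma}$ if $\gamma>0$ and $w(r;0)=r$. Consider the mining game with a cost-advantaged miner described in the context. Suppose the individual miners have exponential utility $U(x)=-\frac1\gamma e^{-\gamma x}$ with $\gamma\ge0$ (for $\gamma=0$ meaning the risk-neutral $U(x)=x$), and the cost-advantaged miner either (i) has exponential utility $U_1(x)=-\frac{1}{\gamma_1}e^{-\gamma_1x}$ with risk-aversion coefficient $\gamma_1>0$, or (ii) is risk-neutral, $U_1(x)=x$ (in which case $\gamma_1=0$). Suppose the relative cost efficiency satisfies $$k_c<\frac{w(r;\gamma_1)}{w(r;\gamma)}\,\frac{M+1}{M},$$ and let $$\kappa=\frac{\mathcal{K}\,w(r;\gamma)}{c},\qquad \kappa_1=\frac{(M+1)\,\mathcal{K}\,w(r;\gamma_1)}{c_1}.$$ Then, in equilibrium, all miners are active with $$\alpha^*(t,x)\equiv\bar\alpha^*_t\equiv\frac{\kappa^2\kappa_1}{(\kappa+\kappa_1)^2}>0,\qquad \beta^*_t\equiv\frac{\kappa\kappa_1(\kappa_1-M\kappa)}{(\kappa+\kappa_1)^2}>0$$ for all $t\in[t_0,T]$ and $x\in\mathbb{R}$.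
   Context: Mining game with a cost-advantaged miner. One cost-advantaged miner competes with $M+1$ individual miners, the latter approximated by a continuum labelled by wealth, with initial wealth density $m_0$ at time $t_0$. Let $\bar\alpha=(\bar\alpha_t)_{t\in[t_0,T]}$, $\bar\alpha_t>0$, be the mean hash rate of the individual miners and $\beta=(\beta_t)_{t\in[t_0,T]}$, $\beta_t\ge0$, the hash rate of the cost-advantaged miner; controls $\beta$ are functions of time only. Cost-advantaged miner: pays $c_1\beta_t$ per unit time, where $c_1=k_c c$ and $k_c$ is the relative cost efficiency, and receives rewards $r$ at the jumps of a counting process $N^1$ with intensity $\frac{\mathcal{K}\beta_t}{\beta_t+(M+1)\bar\alpha_t}$. Given $\bar\alpha$, its best response $\beta^*(\cdot;\bar\alpha)$ is the maximizer of $$\sup_{\beta\ge0}\mathbb{E}\Big[U_1\Big(\int_{t_0}^T-c_1\beta_t\,dt+r\,dN^1_t\Big)\Big].$$ Individual miners: a representative individual miner chooses a Markovian hash rate $\alpha_t=\alpha(t,X_t)\ge0$; its wealth (any value in $\mathbb{R}$) satisfies $dX_t=-c\,\alpha_t\,dt+r\,dN_t$, where $N$ is a counting process with intensity $\frac{\mathcal{K}\alpha_t}{\alpha_t+M\bar\alpha_t+\beta_t}$. The value function is $v(t,x;\bar\alpha,\beta)=\sup_{\alpha\ge0}\mathbb{E}[U(X_T)\mid X_t=x]$. As a standing assumption it is a classical solution of $$\partial_tv+\sup_{\alpha\ge0}\Big(-c\alpha\,\partial_xv+\frac{\mathcal{K}\alpha}{\alpha+M\bar\alpha_t+\beta_t}\Delta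 v\Big)=0,\qquad v(T,x)=U(x),$$ where $\Delta v(t,x)=v(t,x+r)-v(t,x)$; $v$ is strictly increasing in $x$. The optimal individual hash rate is the maximizer $$\alpha^*(t,x;\bar\alpha,\beta)=-(M\bar\alpha_t+\beta_t)+\sqrt{\frac{(M\bar\alpha_t+\beta_t)\,\mathcal{K}\,\Delta v}{c\,\partial_xv}}\quad\text{if } M\bar\alpha_t+\beta_t<\frac{\mathcal{K}\Delta v}{c\,\partial_xv},$$ and $\alpha^*(t,x;\bar\alpha,\beta)=0$ otherwise. Let $m(t,\cdot;\bar\alpha,\beta)$ be the probability density of $X_t$ when the hash rate is $\alpha^*(t,X_t;\bar\alpha,\beta)$ and $X_{t_0}$ has density $m_0$. A pair $(\bar\alpha^*,\beta^* )$ with $\bar\alpha^*_t>0$ for all $t$ is an equilibrium if $$\bar\alpha^*_t=\int_{\mathbb{R}}\alpha^*(t,x;\bar\alpha^*,\beta^* )\,m(t,x;\bar\alpha^*,\beta^* )\,dx\quad\text{for all }t\in[t_0,T],$$ and $\beta^*_t=\beta^*(t;\bar\alpha^* )$, i.e. $\beta^*$ is the best response of the cost-advantaged miner to $\bar\alpha^*$. Write $\alpha^*(t,x)=\alpha^*(t,x;\bar\alpha^*,\beta^* )$. A miner is active if its hash rate is strictly positive. *)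

theory Defs
  imports "HOL-Probability.Probability"
begin

definition exp_utility :: "real \<Rightarrow> real \<Rightarrow> real" where
  "exp_utility \<gamma> x = (if \<gamma> = 0 then x else - exp (- \<gamma> * x) / \<gamma>)"

definition reward_weight :: "real \<Rightarrow> real \<Rightarrow> real" where
  "reward_weight r \<gamma> = (if \<gamma> = 0 then r else (1 - exp (- \<gamma> * r)) / \<gamma>)"

section \<open>Counting processes with an intensity\<close>

text \<open>
  The controlled processes are understood in the weak sense: a control is given, and the
  filtered probability space carrying the process is part of the solution.  HOL cannot quantify
  over sample types inside a formula, so the probability spaces have the fixed sample type
  \<^typ>\<open>nat \<Rightarrow> real\<close>.  This type, with its product sigma-algebra, is a standard Borel space large
  enough for an initial value together with all jump times.
\<close>

type_synonym sample = "nat \<Rightarrow> real"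

definition progressively_measurable ::
    "(real \<Rightarrow> 'w measure) \<Rightarrow> real \<Rightarrow> real \<Rightarrow> (real \<Rightarrow> 'w \<Rightarrow> real) \<Rightarrow> bool" where
  "progressively_measurable F s T Y \<longleftrightarrow>
     (\<forall>t\<in>{s..T}. (\<lambda>(u, \<omega>). Y u \<omega>) \<in> borel_measurable (restrict_space borel {s..t} \<Otimes>\<^sub>M F t))"

text \<open>
  Almost surely \<open>N\<close> counts the points of a finite set \<open>J\<close> of times in \<open>(s, T]\<close>; equivalently, it is
  a right-continuous step function with \<open>N s = 0\<close> and jumps of size one.
\<close>

definition counting_process ::
    "'w measure \<Rightarrow> (real \<Rightarrow> 'w measure) \<Rightarrow> real \<Rightarrow> real \<Rightarrow> (real \<Rightarrow> 'w \<Rightarrow> nat) \<Rightarrow> bool" where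
  "counting_process P F s T N \<longleftrightarrow>
     (\<forall>t\<in>{s..T}. N t \<in> measurable (F t) (count_space UNIV)) \<and>
     (AE \<omega> in P. \<exists>J. finite J \<and> J \<subseteq> {s<..T} \<and> (\<forall>t\<in>{s..T}. N t \<omega> = card (J \<inter> {..t})))"

text \<open>
  The last conjunct says that \<open>N\<close> minus the time integral of \<open>lam\<close> is a martingale, written with
  nonnegative integrals so that no integrability has to be required beforehand.  For an intensity
  depending on the state \<open>X\<close>, it makes no difference whether \<open>X\<close> is evaluated at \<open>t\<close> or at its left
  limit, since only the time integral of \<open>lam\<close> enters.
\<close>

definition has_intensity ::
    "'w measure \<Rightarrow> (real \<Rightarrow> 'w measure) \<Rightarrow> real \<Rightarrow> real \<Rightarrow> (real \<Rightarrow> 'w \<Rightarrow> nat) \<Rightarrow>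
     (real \<Rightarrow> 'w \<Rightarrow> real) \<Rightarrow> bool" where
  "has_intensity P F s T N lam \<longleftrightarrow>
     prob_space P \<and> filtration (space P) F \<and> (\<forall>t. subalgebra P (F t)) \<and>
     counting_process P F s T N \<and>
     progressively_measurable F s T lam \<and> (\<forall>t\<in>{s..T}. \<forall>\<omega>\<in>space P. 0 \<le> lam t \<omega>) \<and>
     (\<forall>u\<in>{s..T}. \<forall>t\<in>{u..T}. \<forall>A\<in>sets (F u).
        (\<integral>\<^sup>+\<omega>\<in>A. of_nat (N t \<omega> - N u \<omega>) \<partial>P) =
        (\<integral>\<^sup>+\<omega>\<in>A. (\<integral>\<^sup>+\<tau>\<in>{u..t}. ennreal (lam \<tau> \<omega>) \<partial>lborel) \<partial>P))"

section \<open>Individual miners\<close>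

text \<open>
  \<open>L t\<close> is the hash rate of all competitors of the representative individual miner, that is,
  \<open>M * \<alpha>b t + \<beta> t\<close> in the game.  The wealth \<open>X\<close> solves
  \<open>dX = - c \<alpha>(t, X) dt + r dN\<close> on \<open>[s, T]\<close> under the Markovian hash rate \<open>\<alpha>\<close>.
\<close>

definition wealth_process ::
    "real \<Rightarrow> real \<Rightarrow> real \<Rightarrow> (real \<Rightarrow> real) \<Rightarrow> real \<Rightarrow> real \<Rightarrow> (real \<Rightarrow> real \<Rightarrow> real) \<Rightarrow>
     'w measure \<Rightarrow> (real \<Rightarrow> 'w measure) \<Rightarrow> (real \<Rightarrow> 'w \<Rightarrow> nat) \<Rightarrow> (real \<Rightarrow> 'w \<Rightarrow> real) \<Rightarrow> bool" where
  "wealth_process K c r L s T \<alpha> P F N X \<longleftrightarrow>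
     (\<lambda>(t, x). \<alpha> t x) \<in> borel_measurable (restrict_space borel ({s..T} \<times> UNIV)) \<and>
     (\<forall>t\<in>{s..T}. \<forall>x. 0 \<le> \<alpha> t x) \<and>
     progressively_measurable F s T X \<and>
     has_intensity P F s T N (\<lambda>t \<omega>. K * \<alpha> t (X t \<omega>) / (\<alpha> t (X t \<omega>) + L t)) \<and>
     (AE \<omega> in P.
        set_integrable lborel {s..T} (\<lambda>u. \<alpha> u (X u \<omega>)) \<and>
        (\<forall>t\<in>{s..T}. X t \<omega> =
           X s \<omega> - c * (LINT u:{s..t}|lborel. \<alpha> u (X u \<omega>)) + r * real (N t \<omega>)))"

text \<open>
  Controls whose terminal utility is not integrable are left out of the supremum: the positive part
  of the utility is always integrable, so they have expected utility minus infinity.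
\<close>

definition value_function ::
    "real \<Rightarrow> real \<Rightarrow> real \<Rightarrow> real \<Rightarrow> (real \<Rightarrow> real) \<Rightarrow> (real \<Rightarrow> real) \<Rightarrow> real \<Rightarrow> real \<Rightarrow> real" where
  "value_function K c r T U L t x =
     Sup {(\<integral>\<omega>. U (X T \<omega>) \<partial>P) | \<alpha> (P :: sample measure) F N X.
            wealth_process K c r L t T \<alpha> P F N X \<and> (AE \<omega> in P. X t \<omega> = x) \<and>
            integrable P (\<lambda>\<omega>. U (X T \<omega>))}"

text \<open>The time derivative is one-sided at the end points \<open>t0\<close> and \<open>T\<close>.\<close>

definition classical_solution ::
    "real \<Rightarrow> real \<Rightarrow> real \<Rightarrow> real \<Rightarrow> real \<Rightarrow> (real \<Rightarrow> real) \<Rightarrow> (real \<Rightarrow> real) \<Rightarrow>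
     (real \<Rightarrow> real \<Rightarrow> real) \<Rightarrow> bool" where
  "classical_solution K c r t0 T U L v \<longleftrightarrow>
     (\<exists>vt vx.
        continuous_on ({t0..T} \<times> UNIV) (\<lambda>(t, x). vt t x) \<and>
        continuous_on ({t0..T} \<times> UNIV) (\<lambda>(t, x). vx t x) \<and>
        (\<forall>t\<in>{t0..T}. \<forall>x.
           ((\<lambda>s. v s x) has_real_derivative vt t x) (at t within {t0..T}) \<and>
           ((\<lambda>y. v t y) has_real_derivative vx t x) (at x) \<and>
           vt t x + (SUP a\<in>{0..}. - c * a * vx t x
                       + K * a / (a + L t) * (v t (x + r) - v t x)) = 0)) \<and>
     (\<forall>x. v T x = U x)"

definition optimal_hash_rate ::
    "real \<Rightarrow> real \<Rightarrow> real \<Rightarrow> real \<Rightarrow> (real \<Rightarrow> real) \<Rightarrow> (real \<Rightarrow> real) \<Rightarrow> real \<Rightarrow> real \<Rightarrow> real" where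
  "optimal_hash_rate K c r T U L t x =
     (let v = value_function K c r T U L;
          q = K * (v t (x + r) - v t x) / (c * deriv (v t) x)
      in if L t < q then - L t + sqrt (L t * q) else 0)"

section \<open>Cost-advantaged miner\<close>

definition admissible_rate :: "real \<Rightarrow> real \<Rightarrow> (real \<Rightarrow> real) \<Rightarrow> bool" where
  "admissible_rate t0 T \<beta> \<longleftrightarrow> set_integrable lborel {t0..T} \<beta> \<and> (\<forall>t\<in>{t0..T}. 0 \<le> \<beta> t)"

text \<open>
  The intensity of \<open>N\<close> is deterministic here, hence determines the law of \<open>N\<close>: the expected utility
  does not depend on the probability space carrying \<open>N\<close>, which justifies the definite description.
\<close>

definition advantaged_utility ::
    "real \<Rightarrow> real \<Rightarrow> real \<Rightarrow> nat \<Rightarrow> real \<Rightarrow> real \<Rightarrow> (real \<Rightarrow> real) \<Rightarrow> (real \<Rightarrow> real) \<Rightarrow>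
     (real \<Rightarrow> real) \<Rightarrow> real" where
  "advantaged_utility K c\<^sub>1 r M t0 T U\<^sub>1 \<alpha>b \<beta> =
     (THE u. \<exists>(P :: sample measure) F N.
        has_intensity P F t0 T N (\<lambda>t \<omega>. K * \<beta> t / (\<beta> t + (real M + 1) * \<alpha>b t)) \<and>
        has_bochner_integral P
          (\<lambda>\<omega>. U\<^sub>1 (- c\<^sub>1 * (LINT t:{t0..T}|lborel. \<beta> t) + r * real (N T \<omega>))) u)"

definition best_response ::
    "real \<Rightarrow> real \<Rightarrow> real \<Rightarrow> nat \<Rightarrow> real \<Rightarrow> real \<Rightarrow> (real \<Rightarrow> real) \<Rightarrow> (real \<Rightarrow> real) \<Rightarrow>
     (real \<Rightarrow> real) \<Rightarrow> bool" where
  "best_response K c\<^sub>1 r M t0 T U\<^sub>1 \<alpha>b \<beta> \<longleftrightarrow>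
     is_arg_max (advantaged_utility K c\<^sub>1 r M t0 T U\<^sub>1 \<alpha>b) (admissible_rate t0 T) \<beta>"

section \<open>Equilibrium\<close>

definition competitors :: "nat \<Rightarrow> (real \<Rightarrow> real) \<Rightarrow> (real \<Rightarrow> real) \<Rightarrow> real \<Rightarrow> real" where
  "competitors M \<alpha>b \<beta> t = real M * \<alpha>b t + \<beta> t"

definition wealth_density ::
    "real \<Rightarrow> real \<Rightarrow> real \<Rightarrow> (real \<Rightarrow> real) \<Rightarrow> real \<Rightarrow> real \<Rightarrow> (real \<Rightarrow> real) \<Rightarrow>
     (real \<Rightarrow> real \<Rightarrow> real) \<Rightarrow> (real \<Rightarrow> real \<Rightarrow> real) \<Rightarrow> bool" where
  "wealth_density K c r L t0 T m\<^sub>0 \<alpha> m \<longleftrightarrow>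
     (\<forall>t\<in>{t0..T}. \<forall>x. 0 \<le> m t x) \<and>
     (\<exists>(P :: sample measure) F N X.
        wealth_process K c r L t0 T \<alpha> P F N X \<and>
        distributed P lborel (X t0) (\<lambda>x. ennreal (m\<^sub>0 x)) \<and>
        (\<forall>t\<in>{t0..T}. distributed P lborel (X t) (\<lambda>x. ennreal (m t x))))"

definition equilibrium ::
    "real \<Rightarrow> real \<Rightarrow> real \<Rightarrow> real \<Rightarrow> nat \<Rightarrow> real \<Rightarrow> real \<Rightarrow> (real \<Rightarrow> real) \<Rightarrow> (real \<Rightarrow> real) \<Rightarrow>
     (real \<Rightarrow> real) \<Rightarrow> (real \<Rightarrow> real) \<Rightarrow> (real \<Rightarrow> real) \<Rightarrow> bool" where
  "equilibrium K c c\<^sub>1 r M t0 T U U\<^sub>1 m\<^sub>0 \<alpha>b \<beta> \<longleftrightarrow>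
     set_borel_measurable borel {t0..T} \<alpha>b \<and> (\<forall>t\<in>{t0..T}. 0 < \<alpha>b t) \<and>
     best_response K c\<^sub>1 r M t0 T U\<^sub>1 \<alpha>b \<beta> \<and>
     (let L = competitors M \<alpha>b \<beta>; \<alpha> = optimal_hash_rate K c r T U L
      in \<exists>m. wealth_density K c r L t0 T m\<^sub>0 \<alpha> m \<and>
           (\<forall>t\<in>{t0..T}. integrable lborel (\<lambda>x. \<alpha> t x * m t x) \<and>
              \<alpha>b t = (\<integral>x. \<alpha> t x * m t x \<partial>lborel)))"

text \<open>The standing assumption on the individual miners' value function, for a given pair of rates.\<close>

definition regular_value ::
    "real \<Rightarrow> real \<Rightarrow> real \<Rightarrow> nat \<Rightarrow> real \<Rightarrow> real \<Rightarrow> (real \<Rightarrow> real) \<Rightarrow> (real \<Rightarrow> real) \<Rightarrow>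
     (real \<Rightarrow> real) \<Rightarrow> bool" where
  "regular_value K c r M t0 T U \<alpha>b \<beta> \<longleftrightarrow>
     (let L = competitors M \<alpha>b \<beta>; v = value_function K c r T U L
      in classical_solution K c r t0 T U L v \<and> (\<forall>t\<in>{t0..T}. strict_mono (v t)))"

end

theory Submission
  imports Defs
begin

text \<open>
  A translation of the wealth scales (for risk-neutral miners: shifts) the value function of an
  individual miner, so \<open>\<Delta>v / \<partial>\<^sub>x v = w(r; \<gamma>)\<close> and the optimal hash rate depends on the
  competitors' hash rate only.  A counting process with deterministic intensity is Poisson, so the
  expected utility of the cost-advantaged miner is an increasing function of a time integral, which
  is maximised pointwise.  The two first-order conditions determine both hash rates for almost
  every \<open>t\<close>, and the HJB equation forces continuity, hence the identity for every \<open>t\<close>.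
\<close>

section \<open>Poisson processes with a deterministic intensity\<close>

text \<open>Two obstacles shape the development. The expected utility of the cost-advantaged miner
  is a definite description over all probability spaces carrying the counting process. Each
  admissible control therefore calls for a construction of such a space on the fixed sample type,
  and for a proof that every space and filtration gives the same expectation. The definition of an
  intensity provides only mean increments on past events; the generating function at
  \<open>exp (- \<gamma> * r)\<close> is all that exponential utility sees of the law, so that is
  what gets computed. The construction serves once more for the converse implication, where constant
  rates turn the wealth into an initial value minus a deterministic cost plus a multiple of a
  Poisson process. The other obstacle is null sets. The mean condition on the individual miners
  holds at every time, but it is one equation for the two numbers \<open>\<alpha>b t\<close> and
  \<open>\<beta> t\<close>; the second equation, from the best response, may fail on a null set.
  Only the regularity of the value function closes this gap. The bound on \<open>k\<^sub>c\<close>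
  enters where the corner \<open>\<beta> t = 0\<close> has to be excluded.\<close>

text \<open>
  The sample \<open>w\<close> consists of an initial value \<open>w 0\<close>, a Poisson number \<open>w 1\<close> of points, and
  independent points \<open>w 2, w 3, \<dots>\<close>.  Adding the mass of \<open>{T<..T+1}\<close> to the intensity measure keeps
  the law of the points normalisable when \<open>lam\<close> vanishes; these extra points are never counted.
\<close>

locale poisson_sample =
  fixes init :: "real measure" and lam :: "real \<Rightarrow> real" and s T :: real
  assumes prob_init: "prob_space init" and sets_init [measurable_cong]: "sets init = sets borel"
    and lam_measurable [measurable]: "lam \<in> borel_measurable borel"
    and lam_nonneg: "0 \<le> lam t"
    and lam_integrable: "integrable lborel (\<lambda>t. lam t * indicator {s..T} t)"
begin

definition total where
  "total = 1 + (\<integral>t. lam t * indicator {s..T} t \<partial>lborel)"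

definition point_law where
  "point_law = density lborel
     (\<lambda>t. ennreal ((lam t * indicator {s..T} t + indicator {T<..T+1} t) / total))"

definition coordinate :: "nat \<Rightarrow> real measure" where
  "coordinate i = (if i = 0 then init else
     if i = 1 then distr (measure_pmf (poisson_pmf total)) borel real else point_law)"

definition P :: "sample measure" where
  "P = PiM UNIV coordinate"

definition num :: "sample \<Rightarrow> nat" where
  "num w = nat \<lfloor>w 1\<rfloor>"

definition N :: "real \<Rightarrow> sample \<Rightarrow> nat" where
  "N t w = card {i. i < num w \<and> w (i + 2) \<le> t}"

definition same_past :: "real \<Rightarrow> sample \<Rightarrow> sample \<Rightarrow> bool" where
  "same_past t w w' \<longleftrightarrow> w 0 = w' 0 \<and> (\<forall>u\<le>t. N u w = N u w')"

text \<open>The events known at time \<open>t\<close> are the measurable sets that cannot tell apart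
  two samples with the same initial value and the same counts up to \<open>t\<close>. Stating the
  invariance directly, instead of generating a sigma-algebra, allows a sample to be modified after
  \<open>t\<close> without leaving or entering such an event.\<close>

definition past_sets :: "real \<Rightarrow> sample set set" where
  "past_sets t = {A \<in> sets P. \<forall>w w'. same_past t w w' \<longrightarrow> (w \<in> A \<longleftrightarrow> w' \<in> A)}"

definition F :: "real \<Rightarrow> sample measure" where
  "F t = sigma UNIV (past_sets t)"

section \<open>Law of the sample: independence and exchangeability of its coordinates\<close>

lemma total_ge_1: "1 \<le> total"
  using lam_nonneg by (simp add: total_def integral_nonneg_AE)

lemma nn_integral_lam:
  "(\<integral>\<^sup>+t. ennreal (lam t * indicator {s..T} t) \<partial>lborel) = ennreal (total - 1)"
  using lam_integrable lam_nonneg by (simp add: total_def nn_integral_eq_integral)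

lemma prob_point_law: "prob_space point_law"
proof
  have "emeasure point_law (space point_law) =
      (\<integral>\<^sup>+t. ennreal ((lam t * indicator {s..T} t + indicator {T<..T+1} t) / total) \<partial>lborel)"
    by (simp add: point_law_def emeasure_density)
  also have "\<dots> = (\<integral>\<^sup>+t. (ennreal (lam t * indicator {s..T} t) + indicator {T<..T+1} t) / ennreal total \<partial>lborel)"
    using total_ge_1 lam_nonneg
    by (intro nn_integral_cong) (auto simp flip: divide_ennreal ennreal_plus ennreal_indicator)
  also have "\<dots> = (ennreal (total - 1) + 1) / ennreal total"
    by (subst nn_integral_divide) (auto simp: nn_integral_add nn_integral_lam)
  also have "ennreal (total - 1) + 1 = ennreal total"
    using total_ge_1 by (simp flip: ennreal_1 ennreal_plus)
  also have "ennreal total / ennreal total = 1"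
    using total_ge_1 by (simp add: divide_ennreal)
  finally show "emeasure point_law (space point_law) = 1" .
qed

lemma prob_coordinate: "prob_space (coordinate i)"
  using prob_init prob_point_law
  by (auto simp: coordinate_def intro!: measure_pmf.prob_space_distr)

lemma sets_coordinate [measurable_cong]: "sets (coordinate i) = sets borel"
  by (auto simp: coordinate_def sets_init point_law_def)

lemma space_coordinate [simp]: "space (coordinate i) = UNIV"
  using sets_eq_imp_space_eq[OF sets_coordinate] by simp

lemma prob_P: "prob_space P"
  unfolding P_def by (intro prob_space_PiM prob_coordinate)

lemma sets_P [measurable_cong]: "sets P = sets (PiM UNIV (\<lambda>_. borel))"
  unfolding P_def by (intro sets_PiM_cong refl sets_coordinate)

lemma space_P [simp]: "space P = UNIV"
  using sets_eq_imp_space_eq[OF sets_P] by (simp add: space_PiM)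

lemma fun_upd_measurable [measurable]:
  "(\<lambda>(y, w). w(i := y)) \<in> measurable (coordinate i \<Otimes>\<^sub>M P) P"
  unfolding P_def
  by (rule measurable_PiM_single') (auto simp: split_beta fun_upd_def)

text \<open>The coordinates are independent, so overwriting one of them by a fresh copy with the
  same law preserves \<open>P\<close>. This is the form in which independence is used below.\<close>

lemma resample:
  assumes [measurable]: "h \<in> borel_measurable P"
  shows "(\<integral>\<^sup>+w. h w \<partial>P) = (\<integral>\<^sup>+y. (\<integral>\<^sup>+w. h (w(i := y)) \<partial>P) \<partial>coordinate i)"
proof -
  interpret P: prob_space P by (rule prob_P)
  have "P = distr (coordinate i \<Otimes>\<^sub>M P) P (\<lambda>(y, w). w(i := y))"
    using distr_pair_PiM_eq_PiM[of UNIV coordinate i] prob_coordinate by (simp add: P_def)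
  then have "(\<integral>\<^sup>+w. h w \<partial>P) = (\<integral>\<^sup>+w. h w \<partial>distr (coordinate i \<Otimes>\<^sub>M P) P (\<lambda>(y, w). w(i := y)))"
    by simp
  also have "\<dots> = (\<integral>\<^sup>+z. h ((\<lambda>(y, w). w(i := y)) z) \<partial>(coordinate i \<Otimes>\<^sub>M P))"
    by (rule nn_integral_distr) measurable
  also have "\<dots> = (\<integral>\<^sup>+y. (\<integral>\<^sup>+w. h ((\<lambda>(y, w). w(i := y)) (y, w)) \<partial>P) \<partial>coordinate i)"
    by (rule P.nn_integral_fst[symmetric]) measurable
  finally show ?thesis by simp
qed

lemma num_measurable [measurable]: "num \<in> measurable P (count_space UNIV)"
  unfolding num_def by measurable

lemma N_eq_sum: "N t w = (\<Sum>i<num w. if w (i + 2) \<le> t then 1 else 0)"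
  unfolding N_def by (subst sum.inter_filter[symmetric]) (auto intro: arg_cong[where f=card])

lemma N_measurable [measurable]: "N t \<in> measurable P (count_space UNIV)"
proof -
  have "(\<lambda>w. (\<lambda>n. \<Sum>i<n. if w (i + 2) \<le> t then 1 else 0) (num w) :: nat) \<in> measurable P (count_space UNIV)"
    by (rule measurable_compose_countable) measurable
  then show ?thesis by (simp add: N_eq_sum[abs_def])
qed

lemma N_diff:
  assumes "u \<le> t"
  shows "N t w - N u w = (\<Sum>i<num w. if u < w (i + 2) \<and> w (i + 2) \<le> t then 1 else 0)"
proof -
  have "N t w = N u w + (\<Sum>i<num w. if u < w (i + 2) \<and> w (i + 2) \<le> t then 1 else 0)"
    unfolding N_eq_sum sum.distrib[symmetric] using assms by (intro sum.cong) auto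
  then show ?thesis by simp
qed

text \<open>All coordinates from 2 on have the law \<open>point_law\<close>, and the shifted
  transposition fixes the coordinates 0 and 1.\<close>

lemma swap_points:
  assumes [measurable]: "h \<in> borel_measurable P"
  shows "(\<integral>\<^sup>+w. h w \<partial>P) = (\<integral>\<^sup>+w. h (w \<circ> Transposition.transpose (i + 2) (j + 2)) \<partial>P)"
proof -
  let ?\<sigma> = "Transposition.transpose (i + 2) (j + 2)"
  have eq: "coordinate (?\<sigma> n) = coordinate n" for n
    by (simp add: coordinate_def Transposition.transpose_def)
  have "distr P P (\<lambda>w. w \<circ> ?\<sigma>) = P"
    using distr_PiM_reindex[of UNIV coordinate ?\<sigma> UNIV] prob_coordinate
    by (simp add: P_def eq o_def restrict_UNIV del: add_2_eq_Suc')
  then have "(\<integral>\<^sup>+w. h w \<partial>P) = (\<integral>\<^sup>+w. h w \<partial>distr P P (\<lambda>w. w \<circ> ?\<sigma>))"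
    by simp
  also have "\<dots> = (\<integral>\<^sup>+w. h (w \<circ> ?\<sigma>) \<partial>P)"
  proof (rule nn_integral_distr)
    show "(\<lambda>w. w \<circ> ?\<sigma>) \<in> measurable P P"
      unfolding P_def by (rule measurable_PiM_single') auto
  qed measurable
  finally show ?thesis .
qed

text \<open>Both indices must belong to the first \<open>num w\<close> points: exchanging a counted
  point with one beyond \<open>num w\<close> could change the count.\<close>

lemma N_swap_points:
  assumes "i < num w" "j < num w"
  shows "N t (w \<circ> Transposition.transpose (i + 2) (j + 2)) = N t w"
proof -
  let ?\<sigma> = "Transposition.transpose (i + 2) (j + 2)"
  have num: "num (w \<circ> ?\<sigma>) = num w" by (simp add: num_def Transposition.transpose_def)
  have "N t (w \<circ> ?\<sigma>) = card (Transposition.transpose i j ` {k. k < num w \<and> (w \<circ> ?\<sigma>) (k + 2) \<le> t})"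
    unfolding N_def num by (rule card_image[symmetric]) (auto intro: inj_on_subset[OF inj_transpose])
  also have "Transposition.transpose i j ` {k. k < num w \<and> (w \<circ> ?\<sigma>) (k + 2) \<le> t} = {k. k < num w \<and> w (k + 2) \<le> t}"
    (is "_ ` ?A = ?B")
  proof (intro set_eqI iffI)
    fix k assume "k \<in> Transposition.transpose i j ` ?A"
    then show "k \<in> ?B" using assms by (auto simp: Transposition.transpose_def)
  next
    fix k assume "k \<in> ?B"
    then have "Transposition.transpose i j k \<in> ?A" using assms by (auto simp: Transposition.transpose_def)
    then show "k \<in> Transposition.transpose i j ` ?A" by (rule image_eqI[rotated]) simp
  qed
  finally show ?thesis unfolding N_def .
qed

section \<open>The filtration of the sample\<close>

lemma same_past_mono: "same_past t w w' \<Longrightarrow> u \<le> t \<Longrightarrow> same_past u w w'"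
  by (simp add: same_past_def)

lemma past_sets_mono: "u \<le> t \<Longrightarrow> past_sets u \<subseteq> past_sets t"
  unfolding past_sets_def using same_past_mono by blast

lemma sigma_algebra_past_sets: "sigma_algebra UNIV (past_sets t)"
proof (unfold sigma_algebra_iff2, intro conjI ballI allI impI)
  fix A assume "A \<in> past_sets t"
  then show "UNIV - A \<in> past_sets t"
    using sets.compl_sets[of A P] by (simp add: past_sets_def)
next
  fix A :: "nat \<Rightarrow> sample set" assume A: "range A \<subseteq> past_sets t"
  then have "\<Union> (range A) \<in> sets P" by (intro sets.countable_UN) (auto simp: past_sets_def)
  with A show "\<Union> (range A) \<in> past_sets t" unfolding past_sets_def by blast
qed (simp_all add: past_sets_def)

lemma space_F [simp]: "space (F t) = UNIV"
  by (simp add: F_def space_measure_of_conv)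

lemma sets_F: "sets (F t) = past_sets t"
  unfolding F_def by (rule sigma_algebra.sets_measure_of_eq[OF sigma_algebra_past_sets])

lemma filtration_F: "filtration (space P) F"
  by standard (simp_all add: sets_F past_sets_mono)

lemma subalgebra_F: "subalgebra P (F t)"
  by (auto simp: subalgebra_def sets_F past_sets_def)

lemma N_adapted: "u \<le> t \<Longrightarrow> N u \<in> measurable (F t) (count_space UNIV)"
  by (rule measurableI)
    (use measurable_sets[OF N_measurable] in \<open>simp_all add: sets_F past_sets_def same_past_def\<close>)

lemma init_adapted: "(\<lambda>w. w 0) \<in> borel_measurable (F t)"
proof (rule measurableI)
  fix A :: "real set" assume "A \<in> sets borel"
  moreover have "(\<lambda>w. w 0) \<in> borel_measurable P" by measurable
  ultimately have "(\<lambda>w. w 0) -` A \<in> sets P"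
    using measurable_sets[of "\<lambda>w. w 0" P borel A] by simp
  then show "(\<lambda>w. w 0) -` A \<inter> space (F t) \<in> sets (F t)" by (simp add: sets_F past_sets_def same_past_def)
qed simp

text \<open>Multiplying by \<open>total\<close> undoes the normalisation, and
  \<open>t \<le> T\<close> keeps the auxiliary mass on \<open>{T<..T+1}\<close> out of the
  interval.\<close>

lemma emeasure_point_law_Ioc:
  assumes "s \<le> u" "u \<le> t" "t \<le> T"
  shows "ennreal total * emeasure point_law {u<..t} = (\<integral>\<^sup>+\<tau>\<in>{u..t}. ennreal (lam \<tau>) \<partial>lborel)"
proof -
  have "ennreal total * emeasure point_law {u<..t} = (\<integral>\<^sup>+\<tau>. ennreal total *
      (ennreal ((lam \<tau> * indicator {s..T} \<tau> + indicator {T<..T+1} \<tau>) / total) * indicator {u<..t} \<tau>) \<partial>lborel)"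
    by (simp add: point_law_def emeasure_density nn_integral_cmult)
  also have "\<dots> = (\<integral>\<^sup>+\<tau>\<in>{u..t}. ennreal (lam \<tau>) \<partial>lborel)"
  proof (rule nn_integral_cong_AE)
    have "AE \<tau> in lborel. \<tau> \<noteq> u" by (rule AE_lborel_singleton)
    then show "AE \<tau> in lborel. ennreal total *
      (ennreal ((lam \<tau> * indicator {s..T} \<tau> + indicator {T<..T+1} \<tau>) / total) * indicator {u<..t} \<tau>)
       = ennreal (lam \<tau>) * indicator {u..t} \<tau>"
    proof eventually_elim
      case (elim \<tau>)
      show ?case
        using assms elim total_ge_1 lam_nonneg[of \<tau>]
        by (auto simp: indicator_def simp flip: ennreal_mult)
    qed
  qed
  finally show ?thesis .
qed

lemma nn_integral_poisson:
  "(\<integral>\<^sup>+y. h y \<partial>coordinate 1) = (\<integral>\<^sup>+k. h (real k) \<partial>poisson_pmf total)"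
  if [measurable]: "h \<in> borel_measurable borel"
  by (simp add: coordinate_def nn_integral_distr)

text \<open>
  This is Mecke's formula for the functional \<open>indicator A\<close>, which is insensitive to points
  after time \<open>u\<close>: a counted point in \<open>{u<..t}\<close> can be moved to the last place and deleted.
\<close>

lemma increment_mean:
  assumes u: "s \<le> u" "u \<le> t" "t \<le> T" and A: "A \<in> sets (F u)"
  shows "(\<integral>\<^sup>+w\<in>A. of_nat (N t w - N u w) \<partial>P) =
    emeasure P A * (\<integral>\<^sup>+\<tau>\<in>{u..t}. ennreal (lam \<tau>) \<partial>lborel)"
proof -
  have A_P [measurable]: "A \<in> sets P" using A by (simp add: sets_F past_sets_def)
  have A_iff: "w \<in> A \<longleftrightarrow> w' \<in> A" if "w 0 = w' 0" "\<And>v. v \<le> u \<Longrightarrow> N v w = N v w'" for w w'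
    using A that by (simp add: sets_F past_sets_def same_past_def)
  let ?p = "\<lambda>k. ennreal (pmf (poisson_pmf total) k)"
  \<comment> \<open>\<open>a m\<close> is the probability of \<open>A\<close> after the number of
    points has been reset to \<open>m\<close>, so it no longer involves coordinate 1.
    \<open>B m i\<close> marks the samples in \<open>A\<close> with exactly \<open>m\<close> points
    whose point number \<open>i\<close> lies in \<open>{u<..t}\<close>; summing over
    \<open>i\<close> and \<open>m\<close> recovers the increment on \<open>A\<close>.\<close>
  define a where "a m = (\<integral>\<^sup>+w. indicator A (w(1 := real m)) \<partial>P)" for m
  define B where "B m i w = (indicator A w * (if num w = m then 1 else 0) *
    (if u < w (i + 2) \<and> w (i + 2) \<le> t then 1 else 0) :: ennreal)" for m i w
  have [measurable]: "B m i \<in> borel_measurable P" for m i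
    unfolding B_def[abs_def] by measurable
  have num_upd [simp]: "num (w(1 := y)) = nat \<lfloor>y\<rfloor>" "num (w(Suc 0 := y)) = nat \<lfloor>y\<rfloor>"
    "num (w(Suc (Suc i) := y)) = num w" for w y i
    by (simp_all add: num_def)
  have [measurable]: "(\<lambda>w. w(1 := y)) \<in> measurable P P" for y
    unfolding P_def by (rule measurable_PiM_single') (auto simp: fun_upd_def)
  have poisson: "(\<integral>\<^sup>+w. indicator A (w(1 := real m)) * (if num w = k then 1 else 0) \<partial>P) = ?p k * a m" for m k
  proof -
    have "(\<integral>\<^sup>+w. indicator A (w(1 := real m)) * (if num w = k then 1 else 0) \<partial>P)
       = (\<integral>\<^sup>+y. (\<integral>\<^sup>+w. indicator A (w(1 := real m)) * (if nat \<lfloor>y\<rfloor> = k then 1 else 0) \<partial>P) \<partial>coordinate 1)"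
      by (subst resample[of _ 1]) simp_all
    also have "\<dots> = (\<integral>\<^sup>+y. a m * (if nat \<lfloor>y\<rfloor> = k then 1 else 0) \<partial>coordinate 1)"
      by (subst nn_integral_multc) (auto simp: a_def)
    also have "\<dots> = (\<integral>\<^sup>+j. a m * (if nat \<lfloor>real j\<rfloor> = k then 1 else 0) \<partial>poisson_pmf total)"
      by (rule nn_integral_poisson) measurable
    also have "\<dots> = (\<integral>\<^sup>+j. a m * indicator {k} j \<partial>poisson_pmf total)"
      by (intro nn_integral_cong) (auto simp: indicator_def)
    also have "\<dots> = ?p k * a m"
      by (simp add: nn_integral_cmult emeasure_pmf_single mult.commute)
    finally show ?thesis .
  qed
  have at_m: "(\<integral>\<^sup>+w. indicator A w * (if num w = m then 1 else 0) \<partial>P) = ?p m * a m" for m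
  proof -
    have "(\<integral>\<^sup>+w. indicator A w * (if num w = m then 1 else 0) \<partial>P) =
        (\<integral>\<^sup>+w. indicator A (w(1 := real m)) * (if num w = m then 1 else 0) \<partial>P)"
    proof (intro nn_integral_cong)
      fix w
      have "w \<in> A \<longleftrightarrow> w(1 := real m) \<in> A" if "num w = m"
        by (rule A_iff) (use that in \<open>auto simp: N_def\<close>)
      then show "indicator A w * (if num w = m then 1 else 0) =
        indicator A (w(1 := real m)) * (if num w = m then 1 else (0::ennreal))"
        by (auto simp: indicator_def)
    qed
    also have "\<dots> = ?p m * a m" by (rule poisson)
    finally show ?thesis .
  qed
  \<comment> \<open>A last point later than \<open>u\<close> is invisible to \<open>A\<close>, so it
    can be deleted by lowering the number of points from \<open>Suc m\<close> to \<open>m\<close>.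
    What remains does not involve coordinate \<open>m + 2\<close>, and that coordinate contributes
    the factor \<open>emeasure point_law {u<..t}\<close>.\<close>
  have last: "(\<integral>\<^sup>+w. B (Suc m) m w \<partial>P) = emeasure point_law {u<..t} * (?p (Suc m) * a m)" for m
  proof -
    have "(\<integral>\<^sup>+w. B (Suc m) m w \<partial>P) = (\<integral>\<^sup>+y. (\<integral>\<^sup>+w. B (Suc m) m (w(m + 2 := y)) \<partial>P) \<partial>coordinate (m + 2))"
      by (rule resample) measurable
    also have "\<dots> = (\<integral>\<^sup>+y. (\<integral>\<^sup>+w. indicator A (w(1 := real m)) *
        (if num w = Suc m then 1 else 0) \<partial>P) * indicator {u<..t} y \<partial>coordinate (m + 2))"
    proof (intro nn_integral_cong)
      fix y
      have "B (Suc m) m (w(m + 2 := y)) = indicator A (w(1 := real m)) *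
        (if num w = Suc m then 1 else 0) * indicator {u<..t} y" for w
      proof -
        have "w(m + 2 := y) \<in> A \<longleftrightarrow> w(1 := real m) \<in> A" if y: "u < y" and num: "num w = Suc m"
        proof (rule A_iff)
          fix v assume "v \<le> u"
          then show "N v (w(m + 2 := y)) = N v (w(1 := real m))"
            using y num unfolding N_def by (intro arg_cong[where f=card]) (auto simp: less_Suc_eq)
        qed simp
        then show ?thesis by (auto simp: B_def indicator_def)
      qed
      then show "(\<integral>\<^sup>+w. B (Suc m) m (w(m + 2 := y)) \<partial>P) = (\<integral>\<^sup>+w. indicator A (w(1 := real m)) *
        (if num w = Suc m then 1 else 0) \<partial>P) * indicator {u<..t} y"
        by (simp add: nn_integral_multc)
    qed
    also have "\<dots> = emeasure point_law {u<..t} * (?p (Suc m) * a m)"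
      unfolding poisson by (subst nn_integral_cmult) (auto simp: coordinate_def point_law_def mult.commute)
    finally show ?thesis .
  qed
  have swap: "(\<integral>\<^sup>+w. B (Suc m) i w \<partial>P) = (\<integral>\<^sup>+w. B (Suc m) m w \<partial>P)" if "i \<le> m" for m i
  proof (subst swap_points[of "B (Suc m) i" i m], measurable, intro nn_integral_cong)
    fix w :: sample
    let ?w' = "w \<circ> Transposition.transpose (i + 2) (m + 2)"
    have num: "num ?w' = num w" by (simp add: num_def Transposition.transpose_def)
    have "?w' \<in> A \<longleftrightarrow> w \<in> A" if "num w = Suc m"
      by (rule A_iff) (use N_swap_points[of i w m] \<open>i \<le> m\<close> that in \<open>auto simp: Transposition.transpose_def\<close>)
    then show "B (Suc m) i ?w' = B (Suc m) m w"
      unfolding B_def num by (auto simp: indicator_def)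
  qed
  \<comment> \<open>The recursion that characterises Poisson weights. It trades the
    \<open>Suc m\<close> choices of a point and the weight of \<open>Suc m\<close> points for
    \<open>total\<close> and the weight of \<open>m\<close> points.\<close>
  have rec: "of_nat (Suc m) * ?p (Suc m) = ennreal total * ?p m" for m
  proof -
    have "real (Suc m) * pmf (poisson_pmf total) (Suc m) = total * pmf (poisson_pmf total) m"
      using total_ge_1 by (simp del: of_nat_Suc)
    then show ?thesis
      using total_ge_1 by (simp add: ennreal_of_nat_eq_real_of_nat del: of_nat_Suc pmf_poisson flip: ennreal_mult)
  qed
  have "(\<integral>\<^sup>+w\<in>A. of_nat (N t w - N u w) \<partial>P) = (\<integral>\<^sup>+w. (\<Sum>k. \<Sum>i<k. B k i w) \<partial>P)"
  proof (intro nn_integral_cong)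
    fix w
    have "(\<Sum>k. \<Sum>i<k. B k i w) = (\<Sum>i<num w. B (num w) i w)"
      by (rule suminf_finite[where N="{num w}", simplified]) (auto simp: B_def)
    also have "\<dots> = of_nat (N t w - N u w) * indicator A w"
      unfolding N_diff[OF u(2)] B_def by (cases "w \<in> A") (simp_all add: if_distrib cong: if_cong)
    finally show "of_nat (N t w - N u w) * indicator A w = (\<Sum>k. \<Sum>i<k. B k i w)" ..
  qed
  also have "\<dots> = (\<Sum>k. \<Sum>i<k. \<integral>\<^sup>+w. B k i w \<partial>P)"
    by (subst nn_integral_suminf) (auto simp: nn_integral_sum)
  \<comment> \<open>A sample without points has no increment, so the summand at 0 is an empty sum
    and the index can be shifted.\<close>
  also have "\<dots> = (\<Sum>m. \<Sum>i<Suc m. \<integral>\<^sup>+w. B (Suc m) i w \<partial>P)"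
    by (subst suminf_offset[where i=1]) (auto simp: lessThan_Suc)
  also have "\<dots> = (\<Sum>m. of_nat (Suc m) * (emeasure point_law {u<..t} * (?p (Suc m) * a m)))"
    by (intro suminf_cong) (simp add: swap last less_Suc_eq_le del: sum.lessThan_Suc of_nat_Suc)
  also have "\<dots> = (\<Sum>m. (ennreal total * emeasure point_law {u<..t}) * (?p m * a m))"
  proof (intro suminf_cong)
    fix m
    let ?e = "emeasure point_law {u<..t}"
    have "of_nat (Suc m) * (?e * (?p (Suc m) * a m)) = (of_nat (Suc m) * ?p (Suc m)) * (?e * a m)"
      by (simp only: mult_ac)
    also have "\<dots> = (ennreal total * ?e) * (?p m * a m)"
      unfolding rec by (simp only: mult_ac)
    finally show "of_nat (Suc m) * (?e * (?p (Suc m) * a m)) = (ennreal total * ?e) * (?p m * a m)" .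
  qed
  also have "\<dots> = (ennreal total * emeasure point_law {u<..t}) * (\<Sum>m. ?p m * a m)"
    by (rule ennreal_suminf_cmult)
  \<comment> \<open>Read backwards, \<open>at_m\<close> splits the probability of \<open>A\<close>
    according to the number of points.\<close>
  also have "(\<Sum>m. ?p m * a m) = (\<integral>\<^sup>+w. (\<Sum>m. indicator A w * (if num w = m then 1 else 0)) \<partial>P)"
    by (subst nn_integral_suminf) (auto simp: at_m)
  also have "\<dots> = (\<integral>\<^sup>+w. indicator A w \<partial>P)"
  proof (intro nn_integral_cong)
    fix w
    show "(\<Sum>m. indicator A w * (if num w = m then 1 else 0)) = (indicator A w :: ennreal)"
      by (subst suminf_finite[where N="{num w}"]) auto
  qed
  finally show ?thesis by (simp add: emeasure_point_law_Ioc[OF u] mult.commute)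
qed

end

text \<open>Every clause sees the intensity on \<open>{s..T}\<close> only. This permits replacing a
  given intensity by its extension by zero, which is measurable and bounded on the whole
  line.\<close>

lemma has_intensity_cong:
  assumes "has_intensity P F s T N lam" and eq: "\<And>t w. t \<in> {s..T} \<Longrightarrow> lam t w = lam' t w"
  shows "has_intensity P F s T N lam'"
proof -
  have "progressively_measurable F s T lam \<Longrightarrow> progressively_measurable F s T lam'"
    unfolding progressively_measurable_def
  proof
    fix t assume "\<forall>t\<in>{s..T}. (\<lambda>(u, w). lam u w) \<in> borel_measurable (restrict_space borel {s..t} \<Otimes>\<^sub>M F t)"
      and t: "t \<in> {s..T}"
    then have "(\<lambda>(u, w). lam u w) \<in> borel_measurable (restrict_space borel {s..t} \<Otimes>\<^sub>M F t)" by blast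
    also have "?this \<longleftrightarrow> (\<lambda>(u, w). lam' u w) \<in> borel_measurable (restrict_space borel {s..t} \<Otimes>\<^sub>M F t)"
      using t by (intro measurable_cong) (auto simp: eq space_pair_measure space_restrict_space)
    finally show "(\<lambda>(u, w). lam' u w) \<in> borel_measurable (restrict_space borel {s..t} \<Otimes>\<^sub>M F t)" .
  qed
  moreover have "(\<integral>\<^sup>+\<tau>\<in>{u..t}. ennreal (lam \<tau> w) \<partial>lborel) = (\<integral>\<^sup>+\<tau>\<in>{u..t}. ennreal (lam' \<tau> w) \<partial>lborel)"
    if "u \<in> {s..T}" "t \<in> {u..T}" for u t w
    using that by (intro nn_integral_cong) (auto simp: indicator_def eq)
  ultimately show ?thesis
    using assms(1) eq unfolding has_intensity_def by simp
qed

section \<open>Progressive measurability by approximation on time grids\<close>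

lemma grid_tendsto: "(\<lambda>n. (of_int \<lfloor>real (Suc n) * u\<rfloor> + 1) / real (Suc n)) \<longlonglongrightarrow> (u::real)"
proof (rule LIMSEQ_I)
  fix e :: real assume "0 < e"
  then obtain m where m: "inverse (real (Suc m)) < e" using reals_Archimedean by blast
  show "\<exists>m. \<forall>n\<ge>m. norm ((of_int \<lfloor>real (Suc n) * u\<rfloor> + 1) / real (Suc n) - u) < e"
  proof (intro exI allI impI)
    fix n assume "m \<le> n"
    have "\<bar>of_int \<lfloor>real (Suc n) * u\<rfloor> + 1 - real (Suc n) * u\<bar> \<le> 1" by linarith
    moreover have "(of_int \<lfloor>real (Suc n) * u\<rfloor> + 1) / real (Suc n) - u =
        (of_int \<lfloor>real (Suc n) * u\<rfloor> + 1 - real (Suc n) * u) / real (Suc n)"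
      by (simp add: diff_divide_distrib del: of_nat_Suc)
    ultimately have "norm ((of_int \<lfloor>real (Suc n) * u\<rfloor> + 1) / real (Suc n) - u) \<le> inverse (real (Suc n))"
      by (simp add: abs_divide inverse_eq_divide divide_right_mono del: of_nat_Suc)
    also have "\<dots> \<le> inverse (real (Suc m))" using \<open>m \<le> n\<close> by (simp add: divide_simps)
    finally show "norm ((of_int \<lfloor>real (Suc n) * u\<rfloor> + 1) / real (Suc n) - u) < e"
      using m by simp
  qed
qed

lemma grid_ge: "u \<le> (of_int \<lfloor>real (Suc n) * u\<rfloor> + 1) / real (Suc n)"
  by (simp add: pos_le_divide_eq mult.commute del: of_nat_Suc)

context poisson_sample
begin

text \<open>Adapted right-continuous paths are progressive. The grid times approach \<open>u\<close>
  from the right, where the counts converge; at a fixed grid level the time takes countably many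
  values, so joint measurability reduces to measurability at fixed times.\<close>

lemma N_progressive: "progressively_measurable F s T (\<lambda>u w. real (N u w))"
  unfolding progressively_measurable_def
proof
  fix t
  let ?M = "restrict_space borel {s..t} \<Otimes>\<^sub>M F t"
  \<comment> \<open>Rounding up may overshoot \<open>t\<close>; the minimum keeps the evaluation
    time inside what \<open>F t\<close> knows.\<close>
  let ?g = "\<lambda>n u. min t ((of_int \<lfloor>real (Suc n) * u\<rfloor> + 1) / real (Suc n))"
  have "(\<lambda>z. real (N (?g n (fst z)) (snd z))) \<in> borel_measurable ?M" for n
  proof -
    have "(\<lambda>z. (\<lambda>k z. real (N (min t ((of_int k + 1) / real (Suc n))) (snd z))) \<lfloor>real (Suc n) * fst z\<rfloor> z)
        \<in> borel_measurable ?M"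
    proof (rule measurable_compose_countable[where
          f="\<lambda>k z. real (N (min t ((of_int k + 1) / real (Suc n))) (snd z))" and
          g="\<lambda>z. \<lfloor>real (Suc n) * fst z\<rfloor>"])
      fix k :: int
      have [measurable]: "N (min t ((of_int k + 1) / real (Suc n))) \<in> measurable (F t) (count_space UNIV)"
        by (rule N_adapted) simp
      show "(\<lambda>z. real (N (min t ((of_int k + 1) / real (Suc n))) (snd z))) \<in> borel_measurable ?M"
        by measurable
    next
      have "(\<lambda>u. \<lfloor>real (Suc n) * u\<rfloor>) \<in> measurable (restrict_space borel {s..t}) (count_space UNIV)"
        by (rule measurable_restrict_space1) measurable
      then show "(\<lambda>z. \<lfloor>real (Suc n) * fst z\<rfloor>) \<in> measurable ?M (count_space UNIV)"
        by (rule measurable_compose[OF measurable_fst])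
    qed
    then show ?thesis by simp
  qed
  moreover have "(\<lambda>n. real (N (?g n u) w)) \<longlonglongrightarrow> real (N u w)" if "u \<le> t" for u w
    unfolding N_eq_sum of_nat_sum
  proof (intro tendsto_sum)
    fix i
    have lim: "(\<lambda>n. ?g n u) \<longlonglongrightarrow> u"
      using tendsto_min[OF tendsto_const grid_tendsto, of t u] that by simp
    show "(\<lambda>n. real (if w (i + 2) \<le> ?g n u then 1 else 0)) \<longlonglongrightarrow> real (if w (i + 2) \<le> u then 1 else 0)"
    proof (cases "w (i + 2) \<le> u")
      case True
      then have "w (i + 2) \<le> ?g n u" for n
        using that grid_ge[of u n] by (simp only: min_def split: if_split) linarith
      with True show ?thesis by simp
    next
      case False
      then have "eventually (\<lambda>n. ?g n u < w (i + 2)) sequentially"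
        using order_tendstoD(2)[OF lim, of "w (i + 2)"] by simp
      then have "eventually (\<lambda>n. real (if w (i + 2) \<le> ?g n u then 1 else 0) = 0) sequentially"
        by eventually_elim auto
      with False show ?thesis by (simp add: tendsto_eventually)
    qed
  qed
  moreover have "fst z \<le> t" if "z \<in> space ?M" for z
    using that by (auto simp: space_pair_measure space_restrict_space)
  ultimately have "(\<lambda>z. real (N (fst z) (snd z))) \<in> borel_measurable ?M"
    by - (rule borel_measurable_LIMSEQ_real[where u="\<lambda>n z. real (N (?g n (fst z)) (snd z))"]; blast)
  then show "(\<lambda>(u, w). real (N u w)) \<in> borel_measurable ?M"
    by (simp add: split_beta')
qed

section \<open>The points are almost surely distinct, and the constructed process has the prescribed
  intensity\<close>

lemma AE_coordinate: "AE y in coordinate i. Q y \<Longrightarrow> AE w in P. Q (w i)"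
  unfolding P_def by (rule AE_PiM_component[OF prob_coordinate]) simp

lemma coordinate_point: "coordinate (i + 2) = point_law"
  by (simp add: coordinate_def)

lemma AE_point_neq: "AE w in P. w (i + 2) \<noteq> y"
proof -
  have "AE z in point_law. z \<noteq> y"
    unfolding point_law_def using AE_lborel_singleton[of y] by (subst AE_density) auto
  then have "AE z in coordinate (i + 2). z \<noteq> y" unfolding coordinate_point .
  then show ?thesis by (rule AE_coordinate)
qed

text \<open>Points lie in \<open>{s..T}\<close> or among the auxiliary ones in
  \<open>{T<..T+1}\<close>. The second alternative is kept apart because the locale allows
  \<open>T < s\<close>.\<close>

lemma AE_points_gt: "AE w in P. s < w (i + 2) \<or> T < w (i + 2)"
proof -
  have "AE z in point_law. s < z \<or> T < z"
    unfolding point_law_def using AE_lborel_singleton[of s]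
    by (subst AE_density) (auto elim!: eventually_mono simp: indicator_def split: if_splits)
  then have "AE z in coordinate (i + 2). s < z \<or> T < z" unfolding coordinate_point .
  then show ?thesis by (rule AE_coordinate)
qed

text \<open>Once one point has been resampled to a fixed value \<open>y\<close>, the independent
  other point has a density and misses \<open>y\<close> almost surely.\<close>

lemma AE_points_distinct:
  assumes "i \<noteq> j"
  shows "AE w in P. w (i + 2) \<noteq> w (j + 2)"
proof -
  have "{w \<in> space P. w (i + 2) = w (j + 2)} \<in> sets P"
    by (rule borel_measurable_eq) measurable
  then have sets: "{w. \<not> w (i + 2) \<noteq> w (j + 2)} \<in> sets P"
    by (simp del: add_2_eq_Suc')
  have "(\<integral>\<^sup>+w. indicator {w. \<not> w (i + 2) \<noteq> w (j + 2)} w \<partial>P) =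
      (\<integral>\<^sup>+y. (\<integral>\<^sup>+w. indicator {w. \<not> w (i + 2) \<noteq> w (j + 2)} (w(i + 2 := y)) \<partial>P) \<partial>coordinate (i + 2))"
    by (rule resample[OF borel_measurable_indicator[OF sets]])
  also have "\<dots> = (\<integral>\<^sup>+y. 0 \<partial>coordinate (i + 2))"
  proof (intro nn_integral_cong)
    fix y
    have "(\<integral>\<^sup>+w. indicator {w. \<not> w (i + 2) \<noteq> w (j + 2)} (w(i + 2 := y)) \<partial>P) = (\<integral>\<^sup>+w. 0 \<partial>P)"
    proof (rule nn_integral_cong_AE)
      show "AE w in P. indicator {w. \<not> w (i + 2) \<noteq> w (j + 2)} (w(i + 2 := y)) = (0 :: ennreal)"
        using AE_point_neq[of j y] by eventually_elim (use assms in simp)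
    qed
    then show "(\<integral>\<^sup>+w. indicator {w. \<not> w (i + 2) \<noteq> w (j + 2)} (w(i + 2 := y)) \<partial>P) = 0"
      by simp
  qed
  finally show ?thesis
    using sets.compl_sets[OF sets] by (subst AE_iff_nn_integral) (simp_all add: Collect_neg_eq Compl_eq_Diff_UNIV)
qed

lemma counting_process_N: "counting_process P F s T N"
  unfolding counting_process_def
proof (intro conjI ballI N_adapted order_refl)
  have "AE w in P. \<forall>i. s < w (i + 2) \<or> T < w (i + 2)"
    unfolding AE_all_countable by (intro allI AE_points_gt)
  moreover have "AE w in P. \<forall>i j. i \<noteq> j \<longrightarrow> w (i + 2) \<noteq> w (j + 2)"
    unfolding AE_all_countable
  proof (intro allI)
    fix i j :: nat
    show "AE w in P. i \<noteq> j \<longrightarrow> w (i + 2) \<noteq> w (j + 2)"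
      using AE_points_distinct[of i j] by (cases "i = j") (simp_all del: add_2_eq_Suc')
  qed
  ultimately show "AE w in P. \<exists>J. finite J \<and> J \<subseteq> {s<..T} \<and> (\<forall>t\<in>{s..T}. N t w = card (J \<inter> {..t}))"
  proof eventually_elim
    case (elim w)
    let ?J = "(\<lambda>i. w (i + 2)) ` {i. i < num w \<and> w (i + 2) \<le> T}"
    have "N t w = card (?J \<inter> {..t})" if "t \<in> {s..T}" for t
    proof -
      have "?J \<inter> {..t} = (\<lambda>i. w (i + 2)) ` {i. i < num w \<and> w (i + 2) \<le> t}"
        using that by auto
      moreover have "inj_on (\<lambda>i. w (i + 2)) {i. i < num w \<and> w (i + 2) \<le> t}"
        using elim(2) by (meson inj_onI)
      ultimately show ?thesis by (simp only: N_def card_image)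
    qed
    moreover have "?J \<subseteq> {s<..T}" using elim(1) by (auto simp: not_less[symmetric])
    ultimately show ?case by (intro exI[of _ ?J]) auto
  qed
qed

theorem has_intensity_N: "has_intensity P F s T N (\<lambda>t w. lam t)"
  unfolding has_intensity_def
proof (intro conjI allI ballI prob_P filtration_F subalgebra_F counting_process_N lam_nonneg)
  show "progressively_measurable F s T (\<lambda>t w. lam t)"
    unfolding progressively_measurable_def
    by (auto simp: split_beta' intro!: measurable_compose[OF measurable_fst] measurable_restrict_space1)
next
  fix u t A assume "u \<in> {s..T}" "t \<in> {u..T}" "A \<in> sets (F u)"
  moreover from this have "A \<in> sets P" using subalgebra_F by (auto simp: subalgebra_def)
  ultimately show "(\<integral>\<^sup>+w\<in>A. of_nat (N t w - N u w) \<partial>P) =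
      (\<integral>\<^sup>+w\<in>A. (\<integral>\<^sup>+\<tau>\<in>{u..t}. ennreal (lam \<tau>) \<partial>lborel) \<partial>P)"
    by (subst increment_mean) (auto simp: nn_integral_multc mult.commute[of _ "indicator _ _"])
qed

text \<open>\<open>N\<close> ignores coordinate 0, so the initial value is independent of the
  counts; this later yields the law of the wealth as a mixture of translates.\<close>

lemma nn_integral_init_N:
  assumes [measurable]: "\<And>n. (\<lambda>y. h y n) \<in> borel_measurable borel"
  shows "(\<integral>\<^sup>+w. h (w 0) (N t w) \<partial>P) = (\<integral>\<^sup>+y. (\<integral>\<^sup>+w. h y (N t w) \<partial>P) \<partial>init)"
proof -
  have "N t (w(0 := y)) = N t w" for w y
    by (simp add: N_def num_def)
  moreover have "(\<lambda>w. h (w 0) (N t w)) \<in> borel_measurable P"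
    by (rule measurable_compose_countable) measurable
  ultimately show ?thesis
    by (subst resample[where i=0]) (simp_all add: coordinate_def)
qed

end

section \<open>Uniqueness of the law\<close>

text \<open>The bounds differ only by the number of jumps beyond the first. The truncated
  \<open>k - 1\<close> matters: for \<open>k = 0\<close> and \<open>k = 1\<close> the excess
  vanishes and both bounds are equalities.\<close>

lemma power_second_order_bounds:
  fixes z :: real
  assumes "0 \<le> z" "z \<le> 1"
  shows "1 - (1 - z) * real k \<le> z ^ k" and "z ^ k \<le> 1 - (1 - z) * real k + real (k - 1)"
proof -
  show "1 - (1 - z) * real k \<le> z ^ k"
    using Bernoulli_inequality[of "z - 1" k] assms by (simp add: algebra_simps)
  show "z ^ k \<le> 1 - (1 - z) * real k + real (k - 1)"
  proof (cases k)
    case (Suc m)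
    have "z ^ Suc m \<le> z" using assms by (simp add: mult_left_le power_le_one)
    moreover have "0 \<le> z * real m" using assms by simp
    ultimately show ?thesis using Suc by (simp add: algebra_simps)
  qed simp
qed

lemma exp_minus_second_order:
  fixes y :: real
  assumes "0 \<le> y"
  shows "\<bar>1 - y - exp (- y)\<bar> \<le> y\<^sup>2"
proof -
  have "exp (- y) \<le> 1 / (1 + y)"
    using assms by (simp add: exp_minus inverse_eq_divide frac_le)
  also have "\<dots> \<le> 1 - y + y\<^sup>2"
  proof -
    have "1 \<le> (1 - y + y\<^sup>2) * (1 + y)"
      using assms by (simp add: algebra_simps power2_eq_square)
    then show ?thesis using assms by (simp add: pos_divide_le_eq)
  qed
  finally show ?thesis using exp_ge_add_one_self[of "- y"] by (simp add: abs_if)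
qed

lemma finite_separated:
  fixes J :: "real set"
  assumes "finite J"
  obtains d where "0 < d" "\<And>x y. x \<in> J \<Longrightarrow> y \<in> J \<Longrightarrow> x \<noteq> y \<Longrightarrow> d \<le> \<bar>x - y\<bar>"
proof
  \<comment> \<open>The inserted 1 gives the minimum a value when \<open>J\<close> has at most one
    element.\<close>
  let ?D = "insert 1 ((\<lambda>(x, y). \<bar>x - y\<bar>) ` {(x, y). x \<in> J \<and> y \<in> J \<and> x \<noteq> y})"
  have "finite {(x, y). x \<in> J \<and> y \<in> J \<and> x \<noteq> y}"
    by (rule finite_subset[of _ "J \<times> J"]) (use assms in auto)
  then have fin: "finite ?D" by simp
  show "0 < Min ?D" using fin by (subst Min_gr_iff) auto
  show "Min ?D \<le> \<bar>x - y\<bar>" if "x \<in> J" "y \<in> J" "x \<noteq> y" for x y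
    by (rule Min_le[OF fin]) (use that in auto)
qed

lemma has_intensity_AE_start:
  assumes "has_intensity P F s T N lam" "s \<le> T"
  shows "AE w in P. N s w = 0"
proof -
  have "AE w in P. \<exists>J. finite J \<and> J \<subseteq> {s<..T} \<and> (\<forall>t\<in>{s..T}. N t w = card (J \<inter> {..t}))"
    using assms(1) by (simp add: has_intensity_def counting_process_def)
  then show ?thesis
  proof eventually_elim
    case (elim w)
    then obtain J where "J \<subseteq> {s<..T}" "N s w = card (J \<inter> {..s})" using assms(2) by auto
    moreover from this have "J \<inter> {..s} = {}" by auto
    ultimately show ?case by simp
  qed
qed

section \<open>Arbitrary probability spaces carrying a process with a bounded deterministic
  intensity\<close>

locale bounded_intensity =
  fixes P :: "'w measure" and F :: "real \<Rightarrow> 'w measure" and s T :: real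
    and N :: "real \<Rightarrow> 'w \<Rightarrow> nat" and lam :: "real \<Rightarrow> real" and K :: real
  assumes intensity: "has_intensity P F s T N (\<lambda>t w. lam t)"
    and lam_measurable [measurable]: "lam \<in> borel_measurable borel"
    and lam_nonneg: "0 \<le> lam t" and lam_le: "lam t \<le> K" and s_le_T: "s \<le> T"
begin

definition cumulated :: "real \<Rightarrow> real" where
  "cumulated t = (LINT \<tau>:{s..t}|lborel. lam \<tau>)"

sublocale prob_space P
  using intensity by (simp add: has_intensity_def)

lemma K_nonneg: "0 \<le> K"
  using lam_nonneg[of 0] lam_le[of 0] by linarith

lemma lam_set_integrable: "set_integrable lborel {u..t} lam"
  unfolding set_integrable_def
proof (rule Bochner_Integration.integrable_bound)
  show "integrable lborel (\<lambda>x. indicator {u..t} x *\<^sub>R K)"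
    using borel_integrable_atLeastAtMost'[of u t "\<lambda>_. K"] by (simp add: set_integrable_def)
qed (use lam_nonneg lam_le K_nonneg in \<open>auto simp: indicator_def\<close>)

lemma cumulated_diff:
  assumes "s \<le> u" "u \<le> t"
  shows "(LINT \<tau>:{u..t}|lborel. lam \<tau>) = cumulated t - cumulated u"
proof -
  have "cumulated t = (LINT \<tau>:{s..u} \<union> {u<..t}|lborel. lam \<tau>)"
    using assms by (simp add: cumulated_def ivl_disj_un_two_touch ivl_disj_un)
  also have "\<dots> = cumulated u + (LINT \<tau>:{u<..t}|lborel. lam \<tau>)"
    unfolding cumulated_def
    by (rule set_integral_Un) (auto intro: lam_set_integrable set_integrable_subset[OF lam_set_integrable[of u t]])
  also have "(LINT \<tau>:{u<..t}|lborel. lam \<tau>) = (LINT \<tau>:{u..t}|lborel. lam \<tau>)"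
    unfolding set_lebesgue_integral_def
  proof (rule integral_cong_AE)
    show "AE x in lborel. indicator {u<..t} x *\<^sub>R lam x = indicator {u..t} x *\<^sub>R lam x"
      using AE_lborel_singleton[of u] by eventually_elim (auto simp: indicator_def)
  qed auto
  finally show ?thesis by simp
qed

lemma cumulated_increment:
  assumes "s \<le> u" "u \<le> t"
  shows "0 \<le> cumulated t - cumulated u" and "cumulated t - cumulated u \<le> K * (t - u)"
proof -
  show "0 \<le> cumulated t - cumulated u"
    unfolding cumulated_diff[OF assms, symmetric] set_lebesgue_integral_def
    by (rule integral_nonneg_AE) (simp add: lam_nonneg)
  have "(LINT \<tau>:{u..t}|lborel. lam \<tau>) \<le> (LINT \<tau>:{u..t}|lborel. K)"
    using borel_integrable_atLeastAtMost'[of u t "\<lambda>_. K"]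
    by (intro set_integral_mono lam_set_integrable lam_le) auto
  also have "\<dots> = K * (t - u)"
    using assms by (simp add: set_lebesgue_integral_def mult.commute)
  finally show "cumulated t - cumulated u \<le> K * (t - u)"
    by (simp only: cumulated_diff[OF assms])
qed

lemma cumulated_s [simp]: "cumulated s = 0"
  using cumulated_increment[of s s] cumulated_diff[of s s] by (simp add: cumulated_def)

lemma nn_integral_lam:
  assumes "s \<le> u" "u \<le> t"
  shows "(\<integral>\<^sup>+\<tau>\<in>{u..t}. ennreal (lam \<tau>) \<partial>lborel) = ennreal (cumulated t - cumulated u)"
proof -
  have "(\<integral>\<^sup>+\<tau>\<in>{u..t}. ennreal (lam \<tau>) \<partial>lborel) = (\<integral>\<^sup>+\<tau>. ennreal (indicator {u..t} \<tau> *\<^sub>R lam \<tau>) \<partial>lborel)"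
    by (intro nn_integral_cong) (auto simp: indicator_def)
  also have "\<dots> = ennreal (LINT \<tau>:{u..t}|lborel. lam \<tau>)"
    using lam_set_integrable[of u t] unfolding set_lebesgue_integral_def set_integrable_def
    by (intro nn_integral_eq_integral) (auto simp: lam_nonneg)
  finally show ?thesis by (simp add: cumulated_diff[OF assms])
qed

lemma N_measurable_F: "t \<in> {s..T} \<Longrightarrow> N t \<in> measurable (F t) (count_space UNIV)"
  using intensity by (simp add: has_intensity_def counting_process_def)

lemma N_measurable: "t \<in> {s..T} \<Longrightarrow> N t \<in> measurable P (count_space UNIV)"
  using intensity by (intro measurable_from_subalg[OF _ N_measurable_F]) (simp_all add: has_intensity_def)

lemma AE_jumps: "AE w in P. \<exists>J. finite J \<and> J \<subseteq> {s<..T} \<and> (\<forall>t\<in>{s..T}. N t w = card (J \<inter> {..t}))"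
  using intensity by (simp add: has_intensity_def counting_process_def)

lemma AE_N_start: "AE w in P. N s w = 0"
  using intensity s_le_T by (rule has_intensity_AE_start)

lemma AE_N_mono: "AE w in P. \<forall>u\<in>{s..T}. \<forall>t\<in>{u..T}. N u w \<le> N t w"
  using AE_jumps
proof eventually_elim
  case (elim w)
  then obtain J where J: "finite J" "\<forall>t\<in>{s..T}. N t w = card (J \<inter> {..t})" by auto
  then have "N u w \<le> N t w" if "u \<in> {s..T}" "t \<in> {u..T}" for u t
    using that by (auto intro!: card_mono)
  then show ?case by blast
qed

text \<open>The intensity property tests the increment on events of \<open>F u\<close> only. The
  countably many events \<open>A k\<close> on which \<open>N u\<close> equals \<open>k\<close> lie
  there, and summing over them reaches every function of \<open>N u\<close>; the deterministic
  intensity factors out of each term.\<close>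

lemma nn_integral_increment:
  fixes g :: "nat \<Rightarrow> ennreal"
  assumes u: "u \<in> {s..T}" and t: "t \<in> {u..T}"
  shows "(\<integral>\<^sup>+w. g (N u w) * of_nat (N t w - N u w) \<partial>P) =
    (\<integral>\<^sup>+w. g (N u w) \<partial>P) * ennreal (cumulated t - cumulated u)"
proof -
  have t': "t \<in> {s..T}" using u t by simp
  note [measurable] = N_measurable[OF u] N_measurable[OF t']
  define A where "A k = N u -` {k} \<inter> space P" for k
  have A_P [measurable]: "A k \<in> sets P" for k
    unfolding A_def using N_measurable[OF u] by (rule measurable_sets) simp
  have A_F: "A k \<in> sets (F u)" for k
  proof -
    have "space (F u) = space P" using intensity by (simp add: has_intensity_def subalgebra_def)
    then show ?thesis using measurable_sets[OF N_measurable_F[OF u], of "{k}"] by (simp add: A_def)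
  qed
  have mean: "(\<integral>\<^sup>+w. indicator (A k) w * of_nat (N t w - N u w) \<partial>P) =
      emeasure P (A k) * ennreal (cumulated t - cumulated u)" for k
  proof -
    have "(\<integral>\<^sup>+w\<in>A k. of_nat (N t w - N u w) \<partial>P) = (\<integral>\<^sup>+w\<in>A k. (\<integral>\<^sup>+\<tau>\<in>{u..t}. ennreal (lam \<tau>) \<partial>lborel) \<partial>P)"
      using intensity u t A_F[of k] unfolding has_intensity_def by blast
    also have "\<dots> = (\<integral>\<^sup>+w\<in>A k. ennreal (cumulated t - cumulated u) \<partial>P)"
      using u t by (simp add: nn_integral_lam)
    also have "\<dots> = ennreal (cumulated t - cumulated u) * emeasure P (A k)"
      by (rule nn_integral_cmult_indicator) measurable
    finally show ?thesis
      by (simp add: mult.commute)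
  qed
  have split: "g (N u w) * y = (\<Sum>k. g k * (indicator (A k) w * y))" if "w \<in> space P" for w y
  proof -
    have "(\<Sum>k. g k * (indicator (A k) w * y)) = (\<Sum>k\<in>{N u w}. g k * (indicator (A k) w * y))"
      by (rule suminf_finite) (auto simp: A_def)
    then show ?thesis using that by (simp add: A_def)
  qed
  have "(\<integral>\<^sup>+w. g (N u w) * of_nat (N t w - N u w) \<partial>P) =
      (\<integral>\<^sup>+w. (\<Sum>k. g k * (indicator (A k) w * of_nat (N t w - N u w))) \<partial>P)"
    by (intro nn_integral_cong split)
  also have "\<dots> = (\<Sum>k. g k * emeasure P (A k) * ennreal (cumulated t - cumulated u))"
    by (subst nn_integral_suminf) (auto simp: nn_integral_cmult mean mult.assoc)
  also have "\<dots> = (\<Sum>k. g k * emeasure P (A k)) * ennreal (cumulated t - cumulated u)"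
    by (rule ennreal_suminf_multc)
  also have "(\<Sum>k. g k * emeasure P (A k)) = (\<integral>\<^sup>+w. (\<Sum>k. g k * (indicator (A k) w * 1)) \<partial>P)"
    by (subst nn_integral_suminf) (auto simp: nn_integral_cmult_indicator)
  also have "\<dots> = (\<integral>\<^sup>+w. g (N u w) * 1 \<partial>P)"
    by (intro nn_integral_cong split[symmetric])
  finally show ?thesis by simp
qed

lemma nn_integral_N: "(\<integral>\<^sup>+w. of_nat (N T w) \<partial>P) = ennreal (cumulated T)"
proof -
  have "(\<integral>\<^sup>+w. of_nat (N T w) \<partial>P) = (\<integral>\<^sup>+w. 1 * of_nat (N T w - N s w) \<partial>P)"
    using AE_N_start by (intro nn_integral_cong_AE) (auto elim!: eventually_mono)
  also have "\<dots> = ennreal (cumulated T)"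
    using nn_integral_increment[of s T "\<lambda>_. 1"] s_le_T by (simp add: emeasure_space_1)
  finally show ?thesis .
qed

text \<open>The mean settles the risk-neutral case, and its finiteness makes \<open>N T\<close> a
  dominating function in the limit of partitions.\<close>

theorem has_bochner_integral_N: "has_bochner_integral P (\<lambda>w. real (N T w)) (cumulated T)"
proof (rule has_bochner_integral_nn_integral)
  show "(\<lambda>w. real (N T w)) \<in> borel_measurable P"
    using N_measurable[of T] s_le_T by simp
  show "(\<integral>\<^sup>+w. ennreal (real (N T w)) \<partial>P) = ennreal (cumulated T)"
    using nn_integral_N by (simp add: ennreal_of_nat_eq_real_of_nat)
qed (use cumulated_increment[of s T] s_le_T in auto)

lemma integrable_N: "t \<in> {s..T} \<Longrightarrow> integrable P (\<lambda>w. real (N t w))"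
proof (rule Bochner_Integration.integrable_bound)
  show "integrable P (\<lambda>w. real (N T w))"
    using has_bochner_integral_N by (simp add: has_bochner_integral_iff)
  assume t: "t \<in> {s..T}"
  then show "(\<lambda>w. real (N t w)) \<in> borel_measurable P"
    using N_measurable[of t] by measurable
  show "AE w in P. norm (real (N t w)) \<le> norm (real (N T w))"
    using AE_N_mono by eventually_elim (use t in auto)
qed

lemma expectation_increment:
  assumes u: "u \<in> {s..T}" and t: "t \<in> {u..T}" and z: "0 \<le> z" "z \<le> 1"
  shows "expectation (\<lambda>w. z ^ N u w * real (N t w - N u w)) =
    expectation (\<lambda>w. z ^ N u w) * (cumulated t - cumulated u)"
proof -
  have t': "t \<in> {s..T}" using u t by simp
  note [measurable] = N_measurable[OF u] N_measurable[OF t']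
  have pow: "integrable P (\<lambda>w. z ^ N u w)"
    by (rule integrable_const_bound[where B=1]) (use z in \<open>auto simp: power_le_one\<close>)
  have "ennreal (expectation (\<lambda>w. z ^ N u w) * (cumulated t - cumulated u)) =
      (\<integral>\<^sup>+w. ennreal (z ^ N u w) \<partial>P) * ennreal (cumulated t - cumulated u)"
    using pow z cumulated_increment[of u t] u t
    by (subst nn_integral_eq_integral) (auto simp: ennreal_mult integral_nonneg_AE)
  also have "\<dots> = (\<integral>\<^sup>+w. ennreal (z ^ N u w * real (N t w - N u w)) \<partial>P)"
    using z by (subst nn_integral_increment[OF u t, symmetric])
      (auto simp: ennreal_mult ennreal_of_nat_eq_real_of_nat intro!: nn_integral_cong)
  finally have "(\<integral>\<^sup>+w. ennreal (z ^ N u w * real (N t w - N u w)) \<partial>P) =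
    ennreal (expectation (\<lambda>w. z ^ N u w) * (cumulated t - cumulated u))" ..
  then show ?thesis
    using z cumulated_increment[of u t] u t
    by (intro integral_eq_nn_integral[THEN trans]) (auto simp: integral_nonneg_AE)
qed

text \<open>Subtraction is truncated on natural numbers: this counts the jumps in
  \<open>{u<..t}\<close> beyond the first and is 0 if there is none.\<close>

definition jump_excess :: "real \<Rightarrow> real \<Rightarrow> 'w \<Rightarrow> real" where
  "jump_excess u t w = real (N t w - N u w - 1)"

lemma integrable_jump_excess:
  assumes "u \<in> {s..T}" "t \<in> {s..T}"
  shows "integrable P (jump_excess u t)"
proof (rule Bochner_Integration.integrable_bound[OF integrable_N[OF assms(2)]])
  note [measurable] = N_measurable[OF assms(1)] N_measurable[OF assms(2)]
  show "jump_excess u t \<in> borel_measurable P"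
    unfolding jump_excess_def by measurable
qed (auto simp: jump_excess_def)

text \<open>Three errors add up. Replacing \<open>z ^ (N t w - N u w)\<close> by its first-order
  expansion costs at most the expected excess of jumps; replacing \<open>1 - y\<close> by
  \<open>exp (- y)\<close> costs \<open>y\<^sup>2\<close>, controlled by the bound \<open>K\<close>
  on the intensity; the earlier error is multiplied by \<open>exp (- y) \<le> 1\<close>, hence not
  amplified.\<close>

lemma generating_function_step:
  assumes u: "u \<in> {s..T}" and t: "t \<in> {u..T}" and z: "0 \<le> z" "z \<le> 1"
  defines "a \<equiv> \<lambda>t. expectation (\<lambda>w. z ^ N t w)"
  shows "\<bar>a t - exp (- (1 - z) * cumulated t)\<bar> \<le> \<bar>a u - exp (- (1 - z) * cumulated u)\<bar>
    + (expectation (jump_excess u t) + (K * (t - u))\<^sup>2)"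
proof -
  have t': "t \<in> {s..T}" using u t by simp
  note [measurable] = N_measurable[OF u] N_measurable[OF t']
  define x where "x = cumulated t - cumulated u"
  define y where "y = (1 - z) * x"
  have x: "0 \<le> x" "x \<le> K * (t - u)"
    using cumulated_increment[of u t] u t by (auto simp: x_def)
  have pow: "integrable P (\<lambda>w. z ^ N v w)" if "v \<in> {s..T}" for v
    by (rule integrable_const_bound[where B=1]) (use z N_measurable[OF that] in \<open>auto simp: power_le_one\<close>)
  have inc: "integrable P (\<lambda>w. z ^ N u w * real (N t w - N u w))"
  proof (rule Bochner_Integration.integrable_bound[OF integrable_N[OF t']])
    have "z ^ N u w * real (N t w - N u w) \<le> 1 * real (N t w)" for w
      using z by (intro mult_mono) (auto simp: power_le_one)
    then show "AE w in P. norm (z ^ N u w * real (N t w - N u w)) \<le> norm (real (N t w))"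
      using z by simp
  qed measurable
  have a_bounds: "0 \<le> a u" "a u \<le> 1"
    using z integral_le_const[OF pow[OF u], of 1] by (auto simp: a_def power_le_one)
  have split: "AE w in P. z ^ N t w = z ^ N u w * z ^ (N t w - N u w)"
    using AE_N_mono by eventually_elim (use u t in \<open>simp flip: power_add\<close>)
  have mean: "expectation (\<lambda>w. z ^ N u w - (1 - z) * (z ^ N u w * real (N t w - N u w))) = a u * (1 - y)"
    using pow[OF u] inc by (simp add: expectation_increment[OF u t z] a_def y_def x_def algebra_simps)
  have "a u * (1 - y) \<le> a t"
    unfolding mean[symmetric] unfolding a_def
  proof (rule integral_mono_AE)
    show "AE w in P. z ^ N u w - (1 - z) * (z ^ N u w * real (N t w - N u w)) \<le> z ^ N t w"
      using split
    proof eventually_elim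
      case (elim w)
      show ?case
        using mult_left_mono[OF power_second_order_bounds(1)[OF z, of "N t w - N u w"], of "z ^ N u w"] z
        by (simp add: elim algebra_simps)
    qed
  qed (use pow[OF u] pow[OF t'] inc in auto)
  moreover have "a t \<le> a u * (1 - y) + expectation (jump_excess u t)"
  proof -
    have "a t \<le> expectation (\<lambda>w. z ^ N u w - (1 - z) * (z ^ N u w * real (N t w - N u w)) + jump_excess u t w)"
      unfolding a_def
    proof (rule integral_mono_AE)
      show "AE w in P. z ^ N t w \<le> z ^ N u w - (1 - z) * (z ^ N u w * real (N t w - N u w)) + jump_excess u t w"
        using split
      proof eventually_elim
        case (elim w)
        have "z ^ N u w * real (N t w - N u w - 1) \<le> 1 * real (N t w - N u w - 1)"
          using z by (intro mult_right_mono) (auto simp: power_le_one)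
        then show ?case
          using mult_left_mono[OF power_second_order_bounds(2)[OF z, of "N t w - N u w"], of "z ^ N u w"] z
          by (simp add: elim algebra_simps jump_excess_def)
      qed
    qed (use pow[OF u] pow[OF t'] inc integrable_jump_excess[OF u t'] in auto)
    also have "\<dots> = a u * (1 - y) + expectation (jump_excess u t)"
      unfolding mean[symmetric] using pow[OF u] inc integrable_jump_excess[OF u t'] by simp
    finally show ?thesis .
  qed
  ultimately have step: "\<bar>a t - a u * (1 - y)\<bar> \<le> expectation (jump_excess u t)" by linarith
  have y: "0 \<le> y" "y \<le> x" using x z by (auto simp: y_def mult_left_le_one_le)
  have "\<bar>a u * (1 - y - exp (- y))\<bar> \<le> 1 * y\<^sup>2"
    unfolding abs_mult using a_bounds exp_minus_second_order[OF y(1)] by (intro mult_mono) auto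
  also have "\<dots> \<le> (K * (t - u))\<^sup>2" using x y by (simp add: power_mono)
  finally have second: "\<bar>a u * (1 - y - exp (- y))\<bar> \<le> (K * (t - u))\<^sup>2" .
  have "\<bar>exp (- y) * (a u - exp (- (1 - z) * cumulated u))\<bar> \<le> \<bar>a u - exp (- (1 - z) * cumulated u)\<bar>"
    unfolding abs_mult using y by (intro mult_left_le_one_le) auto
  moreover have "exp (- (1 - z) * cumulated t) = exp (- y) * exp (- (1 - z) * cumulated u)"
    unfolding exp_add[symmetric] by (simp add: y_def x_def algebra_simps)
  then have "a t - exp (- (1 - z) * cumulated t) = (a t - a u * (1 - y))
      + a u * (1 - y - exp (- y)) + exp (- y) * (a u - exp (- (1 - z) * cumulated u))"
    by (simp add: algebra_simps)
  ultimately show ?thesis using step second by linarith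
qed

text \<open>An interval shorter than the smallest gap between jumps contains at most one of them.
  The gap depends on the path \<open>w\<close>.\<close>

lemma jump_excess_eventually_zero:
  assumes "finite J" "\<forall>t\<in>{s..T}. N t w = card (J \<inter> {..t})"
  obtains d where "0 < d"
    "\<And>u t. u \<in> {s..T} \<Longrightarrow> t \<in> {u..T} \<Longrightarrow> t - u < d \<Longrightarrow> jump_excess u t w = 0"
proof -
  obtain d where d: "0 < d" "\<And>x y. x \<in> J \<Longrightarrow> y \<in> J \<Longrightarrow> x \<noteq> y \<Longrightarrow> d \<le> \<bar>x - y\<bar>"
    using finite_separated[OF assms(1)] by blast
  have "jump_excess u t w = 0" if u: "u \<in> {s..T}" and t: "t \<in> {u..T}" and less: "t - u < d" for u t
  proof -
    have "J \<inter> {..t} = (J \<inter> {..u}) \<union> (J \<inter> {u<..t})" using t by auto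
    then have "card (J \<inter> {..t}) = card (J \<inter> {..u}) + card (J \<inter> {u<..t})"
      using assms(1) by (metis (no_types, lifting) card_Un_disjoint finite_Int Int_assoc
        Int_left_commute inf_bot_right ivl_disj_int_one(3))
    moreover have "card (J \<inter> {u<..t}) \<le> Suc 0"
      using assms(1) d(2) less by (subst card_le_Suc0_iff_eq) (auto, force)
    ultimately show ?thesis using assms(2) u t by (simp add: jump_excess_def)
  qed
  with d(1) show ?thesis by (rule that)
qed

text \<open>
  Watanabe's characterisation of the Poisson process: along a partition, the generating
  function is multiplied by \<open>1 - (1 - z) * dL\<close> up to the expected number of multiple jumps,
  which vanishes as the mesh tends to zero.
\<close>

theorem generating_function:
  assumes z: "0 \<le> z" "z \<le> 1"
  shows "expectation (\<lambda>w. z ^ N T w) = exp (- (1 - z) * cumulated T)"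
proof -
  define a where "a t = expectation (\<lambda>w. z ^ N t w)" for t
  define e where "e t = \<bar>a t - exp (- (1 - z) * cumulated t)\<bar>" for t
  define grid where "grid n i = s + (T - s) * real i / real (Suc n)" for n i
  have grid_mono: "grid n i \<le> grid n j" if "i \<le> j" for n i j
    using that s_le_T unfolding grid_def by (intro add_left_mono divide_right_mono mult_left_mono) auto
  have grid_ends: "grid n 0 = s" "grid n (Suc n) = T" for n
    by (simp_all add: grid_def del: of_nat_Suc)
  have grid_in: "grid n i \<in> {s..T}" if "i \<le> Suc n" for n i
    using grid_mono[of 0 i n] grid_mono[OF that, of n] grid_ends by simp
  have grid_step: "grid n (Suc i) - grid n i = (T - s) / real (Suc n)" for n i
    by (simp add: grid_def algebra_simps del: of_nat_Suc flip: diff_divide_distrib) (simp add: algebra_simps)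
  define S where "S n w = (\<Sum>i<Suc n. jump_excess (grid n i) (grid n (Suc i)) w)" for n w
  have e_s: "e s = 0"
  proof -
    have "a s = expectation (\<lambda>w. 1)"
      unfolding a_def using N_measurable[of s] s_le_T AE_N_start
      by (intro integral_cong_AE) (auto elim!: eventually_mono)
    then show ?thesis by (simp add: e_def prob_space)
  qed
  have S_integrable: "integrable P (S n)" for n
    unfolding S_def using grid_in
    by (intro Bochner_Integration.integrable_sum integrable_jump_excess) auto
  have bound: "e T \<le> expectation (S n) + (K * (T - s))\<^sup>2 / real (Suc n)" for n
  proof -
    have "e (grid n m) \<le> (\<Sum>i<m. expectation (jump_excess (grid n i) (grid n (Suc i))) + (K * ((T - s) / real (Suc n)))\<^sup>2)"
      if "m \<le> Suc n" for m
      using that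
    proof (induction m)
      case 0
      show ?case by (simp add: grid_ends e_s)
    next
      case (Suc m)
      have "e (grid n (Suc m)) \<le> e (grid n m) + (expectation (jump_excess (grid n m) (grid n (Suc m)))
          + (K * (grid n (Suc m) - grid n m))\<^sup>2)"
        unfolding e_def a_def using Suc.prems grid_in[of m n] grid_in[of "Suc m" n] grid_mono[of m "Suc m" n]
        by (intro generating_function_step z) auto
      then show ?case using Suc by (simp add: grid_step del: of_nat_Suc)
    qed
    from this[of "Suc n"] have "e T \<le> (\<Sum>i<Suc n. expectation (jump_excess (grid n i) (grid n (Suc i)))) +
        real (Suc n) * (K * ((T - s) / real (Suc n)))\<^sup>2"
      by (simp add: grid_ends sum.distrib del: of_nat_Suc sum.lessThan_Suc)
    also have "(\<Sum>i<Suc n. expectation (jump_excess (grid n i) (grid n (Suc i)))) = expectation (S n)"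
      unfolding S_def using grid_in
      by (intro Bochner_Integration.integral_sum[symmetric] integrable_jump_excess) auto
    also have "real (Suc n) * (K * ((T - s) / real (Suc n)))\<^sup>2 = (K * (T - s))\<^sup>2 / real (Suc n)"
      by (simp add: power2_eq_square del: of_nat_Suc)
    finally show ?thesis .
  qed
  \<comment> \<open>The mesh below which multiple jumps disappear varies with the path, so there is
    only pointwise convergence. Dominated convergence applies because the excesses over a partition
    add up to at most the total number of jumps.\<close>
  have "(\<lambda>n. expectation (S n)) \<longlonglongrightarrow> expectation (\<lambda>w. 0)"
  proof (rule integral_dominated_convergence[where w="\<lambda>w. real (N T w)"])
    show "integrable P (\<lambda>w. real (N T w))" using s_le_T by (intro integrable_N) simp
    show "S n \<in> borel_measurable P" for n
      using S_integrable by (rule borel_measurable_integrable)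
    show "AE w in P. (\<lambda>n. S n w) \<longlonglongrightarrow> 0"
      using AE_jumps
    proof eventually_elim
      case (elim w)
      then obtain J where J: "finite J" "\<forall>t\<in>{s..T}. N t w = card (J \<inter> {..t})" by blast
      obtain d where d: "0 < d"
        "\<And>u t. u \<in> {s..T} \<Longrightarrow> t \<in> {u..T} \<Longrightarrow> t - u < d \<Longrightarrow> jump_excess u t w = 0"
        using jump_excess_eventually_zero[OF J] by blast
      have "(\<lambda>n. (T - s) / real (Suc n)) \<longlonglongrightarrow> 0"
        using lim_const_over_n[of "T - s", THEN LIMSEQ_Suc] by simp
      then have "eventually (\<lambda>n. (T - s) / real (Suc n) < d) sequentially"
        using d(1) by (rule order_tendstoD)
      then have "eventually (\<lambda>n. S n w = 0) sequentially"
      proof eventually_elim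
        case (elim n)
        have "jump_excess (grid n i) (grid n (Suc i)) w = 0" if "i < Suc n" for i
        proof (rule d(2))
          show "grid n i \<in> {s..T}" using that by (intro grid_in) simp
          show "grid n (Suc i) \<in> {grid n i..T}"
            using that grid_in[of "Suc i" n] grid_mono[of i "Suc i" n] by simp
        qed (use elim grid_step in simp)
        then show ?case by (simp add: S_def del: sum.lessThan_Suc)
      qed
      then show ?case by (rule tendsto_eventually)
    qed
    show "AE w in P. norm (S n w) \<le> real (N T w)" for n
      using AE_N_mono
    proof eventually_elim
      case (elim w)
      have "S n w \<le> (\<Sum>i<Suc n. real (N (grid n (Suc i)) w) - real (N (grid n i) w))"
        unfolding S_def
      proof (rule sum_mono)
        fix i assume "i \<in> {..<Suc n}"
        then have "N (grid n i) w \<le> N (grid n (Suc i)) w"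
          using elim grid_in[of i n] grid_in[of "Suc i" n] grid_mono[of i "Suc i" n] by auto
        then show "jump_excess (grid n i) (grid n (Suc i)) w \<le> real (N (grid n (Suc i)) w) - real (N (grid n i) w)"
          by (simp add: jump_excess_def)
      qed
      also have "\<dots> = real (N T w) - real (N s w)"
        by (subst sum_lessThan_telescope) (simp add: grid_ends)
      finally show ?case by (simp add: S_def sum_nonneg jump_excess_def del: sum.lessThan_Suc)
    qed
  qed simp_all
  then have "(\<lambda>n. expectation (S n) + (K * (T - s))\<^sup>2 / real (Suc n)) \<longlonglongrightarrow> 0 + 0"
    using lim_const_over_n[of "(K * (T - s))\<^sup>2", THEN LIMSEQ_Suc] by (intro tendsto_add) simp_all
  then have "e T \<le> 0"
    using bound by (intro LIMSEQ_le_const) auto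
  then show ?thesis by (simp add: e_def a_def)
qed

end

section \<open>Best response of the cost-advantaged miner\<close>

lemma exp_utility_strict_mono:
  assumes "0 \<le> \<gamma>"
  shows "strict_mono (exp_utility \<gamma>)"
  using assms by (auto simp: strict_mono_def exp_utility_def divide_strict_right_mono)

lemma reward_weight_pos: "0 \<le> \<gamma> \<Longrightarrow> 0 < r \<Longrightarrow> 0 < reward_weight r \<gamma>"
  by (auto simp: reward_weight_def)

text \<open>Up to a constant factor, exponential utility of \<open>b + r * N\<close> is
  \<open>z ^ N\<close> with \<open>z = exp (- \<gamma> * r)\<close>, and
  \<open>0 \<le> \<gamma>\<close> places \<open>z\<close> in the unit interval. The generating
  function then exhibits \<open>b + reward_weight r \<gamma> * cumulated T\<close> as the certainty
  equivalent; this is the origin of \<open>reward_weight\<close>.\<close>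

lemma (in bounded_intensity) has_bochner_integral_exp_utility:
  assumes "0 \<le> \<gamma>" "0 < r"
  shows "has_bochner_integral P (\<lambda>w. exp_utility \<gamma> (b + r * real (N T w)))
    (exp_utility \<gamma> (b + reward_weight r \<gamma> * cumulated T))"
proof (cases "\<gamma> = 0")
  case True
  have "has_bochner_integral P (\<lambda>w. b + r * real (N T w)) (b * prob (space P) + r * cumulated T)"
    by (intro has_bochner_integral_add has_bochner_integral_mult_right has_bochner_integral_N)
      (simp add: has_bochner_integral_iff)
  then show ?thesis using True by (simp add: exp_utility_def reward_weight_def prob_space)
next
  case False
  define z where "z = exp (- \<gamma> * r)"
  have z: "0 \<le> z" "z \<le> 1" using assms by (auto simp: z_def)
  have "T \<in> {s..T}" using s_le_T by simp
  from N_measurable[OF this] have "integrable P (\<lambda>w. z ^ N T w)"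
    by (intro integrable_const_bound[where B=1]) (use z in \<open>auto simp: power_le_one\<close>)
  then have "has_bochner_integral P (\<lambda>w. - exp (- \<gamma> * b) / \<gamma> * z ^ N T w)
      (- exp (- \<gamma> * b) / \<gamma> * exp (- (1 - z) * cumulated T))"
    by (intro has_bochner_integral_mult_right) (simp add: has_bochner_integral_iff generating_function[OF z])
  moreover have "- exp (- \<gamma> * b) / \<gamma> * z ^ N T w = exp_utility \<gamma> (b + r * real (N T w))" for w
    using False by (simp add: exp_utility_def z_def exp_of_nat_mult[symmetric] exp_add[symmetric] algebra_simps)
  moreover have "- exp (- \<gamma> * b) / \<gamma> * exp (- (1 - z) * cumulated T) =
      exp_utility \<gamma> (b + reward_weight r \<gamma> * cumulated T)"
    using False
    by (simp add: exp_utility_def reward_weight_def z_def exp_add[symmetric] algebra_simps diff_divide_distrib)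
  ultimately show ?thesis by simp
qed

text \<open>The rate at which the certainty equivalent grows, in units of the cost per hash:
  \<open>b\<close> is the own hash rate, \<open>A\<close> that of the rivals.\<close>

definition gain :: "real \<Rightarrow> real \<Rightarrow> real \<Rightarrow> real" where
  "gain q A b = q * b / (b + A) - b"

text \<open>The solution of the first-order condition \<open>(b + A)\<^sup>2 = A * q\<close>, cut
  off at 0.\<close>

definition reply :: "real \<Rightarrow> real \<Rightarrow> real" where
  "reply q A = max 0 (sqrt (A * q) - A)"

text \<open>Completing the square with \<open>p = sqrt (A * q)\<close> gives
  \<open>gain q A b = q + A - 2 * p - (b + A - p)\<^sup>2 / (b + A)\<close>. If
  \<open>p < A\<close>, then \<open>q < A\<close> and every positive \<open>b\<close> has a negative
  gain. Strictness is what later makes the best response unique almost everywhere.\<close>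

lemma gain_less_reply:
  assumes "0 < q" "0 < A" "0 \<le> b" "b \<noteq> reply q A"
  shows "gain q A b < gain q A (reply q A)"
proof -
  define p where "p = sqrt (A * q)"
  have p: "0 < p" "p\<^sup>2 = A * q" using assms by (auto simp: p_def)
  show ?thesis
  proof (cases "A \<le> p")
    case True
    then have reply: "reply q A = p - A" by (simp add: reply_def p_def)
    have gain: "gain q A x = q + A - 2 * p - (x + A - p)\<^sup>2 / (x + A)" if "0 \<le> x" for x
    proof -
      have "x + A \<noteq> 0" using that assms by simp
      then have "gain q A x * (x + A) = q * x - x * (x + A)"
        by (simp add: gain_def left_diff_distrib)
      also have "\<dots> = (q + A - 2 * p) * (x + A) - (x + A - p)\<^sup>2"
        using p(2) by (simp add: algebra_simps power2_eq_square)
      finally have "gain q A x * (x + A) = (q + A - 2 * p) * (x + A) - (x + A - p)\<^sup>2" .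
      then show ?thesis using \<open>x + A \<noteq> 0\<close> by (simp add: field_simps)
    qed
    have "0 < (b + A - p)\<^sup>2 / (b + A)" using assms reply by (intro divide_pos_pos) auto
    then show ?thesis using True assms by (simp add: gain reply)
  next
    case False
    then have reply: "reply q A = 0" by (simp add: reply_def p_def)
    have "p\<^sup>2 < A\<^sup>2" using False p(1) by (intro power_strict_mono) auto
    then have "A * q < A * A" using p(2) by (simp add: power2_eq_square)
    then have "q < A" using assms by simp
    then have "q * b < b * (b + A)" using assms reply by (simp add: distrib_left mult.commute add_strict_increasing2)
    then show ?thesis using assms by (simp add: gain_def reply divide_less_eq)
  qed
qed

lemma gain_le_reply: "0 < q \<Longrightarrow> 0 < A \<Longrightarrow> 0 \<le> b \<Longrightarrow> gain q A b \<le> gain q A (reply q A)"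
  using gain_less_reply[of q A b] by (cases "b = reply q A") auto

text \<open>The upper bound, from the inequality of arithmetic and geometric means, is uniform in
  \<open>A\<close>: the reply is integrable however large the mean hash rate of the individual
  miners may be.\<close>

lemma reply_bounds:
  assumes "0 < q" "0 < A"
  shows "0 \<le> reply q A" "reply q A \<le> q"
proof -
  have "sqrt (A * q) \<le> (A + q) / 2" using assms by (intro arith_geo_mean_sqrt) auto
  then show "reply q A \<le> q" using assms by (auto simp: reply_def)
qed (simp add: reply_def)

section \<open>The objective of the cost-advantaged miner as a time integral\<close>

locale mining_cost =
  fixes K c\<^sub>1 r t0 T \<gamma> :: real and M :: nat and \<alpha>b :: "real \<Rightarrow> real"
  assumes K_pos: "0 < K" and c1_pos: "0 < c\<^sub>1" and r_pos: "0 < r" and t0_le: "t0 \<le> T" and \<gamma>_nonneg: "0 \<le> \<gamma>"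
    and alpha_measurable: "set_borel_measurable borel {t0..T} \<alpha>b"
    and alpha_pos: "t \<in> {t0..T} \<Longrightarrow> 0 < \<alpha>b t"
begin

abbreviation rivals :: "real \<Rightarrow> real" where
  "rivals t \<equiv> (real M + 1) * \<alpha>b t"

definition ratio :: real where
  "ratio = K * reward_weight r \<gamma> / c\<^sub>1"

lemma ratio_pos: "0 < ratio"
  using reward_weight_pos[OF \<gamma>_nonneg r_pos] K_pos c1_pos by (simp add: ratio_def)

lemma rivals_pos: "t \<in> {t0..T} \<Longrightarrow> 0 < rivals t"
  using alpha_pos by simp

lemma alpha_indicator_measurable [measurable]: "(\<lambda>t. indicator {t0..T} t * \<alpha>b t) \<in> borel_measurable borel"
  using alpha_measurable by (simp add: set_borel_measurable_def)

lemma admissible_indicator_measurable: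
  "admissible_rate t0 T b \<Longrightarrow> (\<lambda>t. indicator {t0..T} t * b t) \<in> borel_measurable borel"
  unfolding admissible_rate_def set_integrable_def by (auto dest: borel_measurable_integrable)

lemma success_rate_measurable:
  assumes "admissible_rate t0 T b"
  shows "(\<lambda>t. indicator {t0..T} t * (k * b t / (b t + rivals t))) \<in> borel_measurable borel"
proof -
  note [measurable] = admissible_indicator_measurable[OF assms]
  \<comment> \<open>Both rates are measurable only after multiplication by the indicator. It can be
    moved inside because the numerator vanishes outside the interval, and
    \<open>0 / 0 = 0\<close>.\<close>
  have "(\<lambda>t. k * (indicator {t0..T} t * b t) /
      (indicator {t0..T} t * b t + (real M + 1) * (indicator {t0..T} t * \<alpha>b t))) \<in> borel_measurable borel"
    by measurable
  also have "(\<lambda>t. k * (indicator {t0..T} t * b t) /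
      (indicator {t0..T} t * b t + (real M + 1) * (indicator {t0..T} t * \<alpha>b t))) =
    (\<lambda>t. indicator {t0..T} t * (k * b t / (b t + rivals t)))"
    by (auto simp: indicator_def fun_eq_iff)
  finally show ?thesis .
qed

lemma success_rate_bounds:
  assumes "admissible_rate t0 T b" "0 < k" "t \<in> {t0..T}"
  shows "0 \<le> k * b t / (b t + rivals t)" "k * b t / (b t + rivals t) \<le> k"
proof -
  have "0 \<le> b t" "0 < rivals t" using assms rivals_pos by (auto simp: admissible_rate_def)
  then show "0 \<le> k * b t / (b t + rivals t)" "k * b t / (b t + rivals t) \<le> k"
    using assms(2) by (auto simp: divide_le_eq)
qed

lemma success_rate_integrable:
  assumes "admissible_rate t0 T b" "0 < k"
  shows "set_integrable lborel {t0..T} (\<lambda>t. k * b t / (b t + rivals t))"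
  unfolding set_integrable_def
proof (rule Bochner_Integration.integrable_bound)
  show "integrable lborel (\<lambda>x. indicator {t0..T} x *\<^sub>R k)"
    using borel_integrable_atLeastAtMost'[of t0 T "\<lambda>_. k"] by (simp add: set_integrable_def)
  show "(\<lambda>t. indicator {t0..T} t *\<^sub>R (k * b t / (b t + rivals t))) \<in> borel_measurable lborel"
    using success_rate_measurable[OF assms(1)] by simp
  show "AE t in lborel. norm (indicator {t0..T} t *\<^sub>R (k * b t / (b t + rivals t))) \<le> norm (indicator {t0..T} t *\<^sub>R k)"
  proof (rule AE_I2)
    fix t
    show "norm (indicator {t0..T} t *\<^sub>R (k * b t / (b t + rivals t))) \<le> norm (indicator {t0..T} t *\<^sub>R k)"
      using success_rate_bounds[OF assms, of t] assms(2)
      by (cases "t \<in> {t0..T}") (simp_all del: abs_divide add: abs_of_nonneg)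
  qed
qed

lemma gain_integrable:
  assumes "admissible_rate t0 T b"
  shows "set_integrable lborel {t0..T} (\<lambda>t. gain ratio (rivals t) (b t))"
  unfolding gain_def using assms ratio_pos
  by (intro set_integral_diff success_rate_integrable) (auto simp: admissible_rate_def)

text \<open>The definite description needs both halves: \<open>poisson_sample\<close> provides a
  space carrying the process, and the certainty equivalent computed on an arbitrary space shows that
  no other value is possible.\<close>

lemma advantaged_utility_eq:
  assumes b: "admissible_rate t0 T b"
  shows "advantaged_utility K c\<^sub>1 r M t0 T (exp_utility \<gamma>) \<alpha>b b =
    exp_utility \<gamma> (c\<^sub>1 * (LINT t:{t0..T}|lborel. gain ratio (rivals t) (b t)))"
proof -
  \<comment> \<open>The cut-off makes the intensity measurable and bounded on the whole line, as
    both locales require.\<close>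
  define lam where "lam t = indicator {t0..T} t * (K * b t / (b t + rivals t))" for t
  define B where "B = (LINT t:{t0..T}|lborel. b t)"
  have lam_eq: "lam t = K * b t / (b t + rivals t)" if "t \<in> {t0..T}" for t
    using that by (simp add: lam_def)
  have lam_measurable: "lam \<in> borel_measurable borel"
    unfolding lam_def using success_rate_measurable[OF b] .
  have lam: "0 \<le> lam t" "lam t \<le> K" for t
    using success_rate_bounds[OF b K_pos, of t] K_pos by (auto simp: lam_def indicator_def)
  have lam_integrable: "integrable lborel (\<lambda>t. lam t * indicator {t0..T} t)"
  proof -
    have "(\<lambda>t. lam t * indicator {t0..T} t) = (\<lambda>t. indicator {t0..T} t *\<^sub>R (K * b t / (b t + rivals t)))"
      by (auto simp: lam_def indicator_def)
    then show ?thesis using success_rate_integrable[OF b K_pos] by (simp only: set_integrable_def)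
  qed
  let ?u = "exp_utility \<gamma> (c\<^sub>1 * (LINT t:{t0..T}|lborel. gain ratio (rivals t) (b t)))"
  have utility: "has_bochner_integral P (\<lambda>w. exp_utility \<gamma> (- c\<^sub>1 * B + r * real (N T w))) ?u"
    if "has_intensity P F t0 T N (\<lambda>t w. K * b t / (b t + rivals t))"
    for P :: "sample measure" and F N
  proof -
    interpret bounded_intensity P F t0 T N lam K
      by standard (use has_intensity_cong[OF that, of "\<lambda>t w. lam t"] lam lam_eq lam_measurable t0_le in auto)
    have "c\<^sub>1 * (LINT t:{t0..T}|lborel. gain ratio (rivals t) (b t)) =
        c\<^sub>1 * ((LINT t:{t0..T}|lborel. ratio * b t / (b t + rivals t)) - B)"
      unfolding gain_def B_def using b ratio_pos
      by (subst set_integral_diff) (auto intro: success_rate_integrable simp: admissible_rate_def)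
    also have "(LINT t:{t0..T}|lborel. ratio * b t / (b t + rivals t)) =
        (LINT t:{t0..T}|lborel. (reward_weight r \<gamma> / c\<^sub>1) * lam t)"
      by (intro set_lebesgue_integral_cong) (auto simp: ratio_def lam_eq)
    also have "\<dots> = (reward_weight r \<gamma> / c\<^sub>1) * cumulated T"
      by (simp add: cumulated_def)
    also have "c\<^sub>1 * (\<dots> - B) = - c\<^sub>1 * B + reward_weight r \<gamma> * cumulated T"
      using c1_pos by (simp add: algebra_simps)
    finally show ?thesis
      using has_bochner_integral_exp_utility[OF \<gamma>_nonneg r_pos, of "- c\<^sub>1 * B"] by simp
  qed
  \<comment> \<open>This miner has no initial state; a point mass fills coordinate 0.\<close>
  interpret poisson_sample "return borel 0" lam t0 T
    by (rule poisson_sample.intro) (simp_all add: prob_space_return lam lam_measurable lam_integrable)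
  have "has_intensity P F t0 T N (\<lambda>t w. K * b t / (b t + rivals t))"
    by (rule has_intensity_cong[OF has_intensity_N]) (rule lam_eq)
  then show ?thesis
    unfolding advantaged_utility_def B_def[symmetric]
    by (intro the_equality) (blast intro: utility, blast intro: utility dest: has_bochner_integral_eq)
qed

lemma reply_admissible: "admissible_rate t0 T (\<lambda>t. reply ratio (rivals t))"
  unfolding admissible_rate_def
proof (intro conjI ballI)
  show "set_integrable lborel {t0..T} (\<lambda>t. reply ratio (rivals t))"
    unfolding set_integrable_def
  proof (rule Bochner_Integration.integrable_bound)
    show "integrable lborel (\<lambda>x. indicator {t0..T} x *\<^sub>R ratio)"
      using borel_integrable_atLeastAtMost'[of t0 T "\<lambda>_. ratio"] by (simp add: set_integrable_def)
    \<comment> \<open>The indicator may move inside since \<open>reply ratio 0 = 0\<close>.\<close>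
    have "(\<lambda>t. reply ratio ((real M + 1) * (indicator {t0..T} t * \<alpha>b t))) \<in> borel_measurable borel"
      unfolding reply_def by measurable
    also have "(\<lambda>t. reply ratio ((real M + 1) * (indicator {t0..T} t * \<alpha>b t))) =
        (\<lambda>t. indicator {t0..T} t *\<^sub>R reply ratio (rivals t))"
      by (auto simp: reply_def indicator_def)
    finally show "(\<lambda>t. indicator {t0..T} t *\<^sub>R reply ratio (rivals t)) \<in> borel_measurable lborel"
      by simp
    show "AE t in lborel. norm (indicator {t0..T} t *\<^sub>R reply ratio (rivals t)) \<le> norm (indicator {t0..T} t *\<^sub>R ratio)"
      using reply_bounds[OF ratio_pos rivals_pos] ratio_pos by (auto simp: indicator_def)
  qed
  show "0 \<le> reply ratio (rivals t)" for t
    by (simp add: reply_def)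
qed

text \<open>Null sets do not affect the objective, so the maximiser can be pinned down only almost
  everywhere. The pointwise maximiser is itself admissible; any competitor with the same integral
  has an integrand gap that is nonnegative with integral 0, and strictness of the pointwise maximum
  turns a vanishing gap into equality of the rates.\<close>

theorem best_response_iff:
  "best_response K c\<^sub>1 r M t0 T (exp_utility \<gamma>) \<alpha>b b \<longleftrightarrow>
    admissible_rate t0 T b \<and> (AE t in lborel. t \<in> {t0..T} \<longrightarrow> b t = reply ratio (rivals t))"
proof -
  define G where "G b = (LINT t:{t0..T}|lborel. gain ratio (rivals t) (b t))" for b
  define R where "R t = reply ratio (rivals t)" for t
  have R: "admissible_rate t0 T R" unfolding R_def by (rule reply_admissible)
  have utility_le: "advantaged_utility K c\<^sub>1 r M t0 T (exp_utility \<gamma>) \<alpha>b b \<le>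
      advantaged_utility K c\<^sub>1 r M t0 T (exp_utility \<gamma>) \<alpha>b b' \<longleftrightarrow> G b \<le> G b'"
    if "admissible_rate t0 T b" "admissible_rate t0 T b'" for b b'
    using that c1_pos by (simp add: advantaged_utility_eq strict_mono_less_eq[OF exp_utility_strict_mono[OF \<gamma>_nonneg]] G_def)
  have G_diff: "G R - G b = (\<integral>t. indicator {t0..T} t * (gain ratio (rivals t) (R t) - gain ratio (rivals t) (b t)) \<partial>lborel)"
    and diff_integrable: "integrable lborel (\<lambda>t. indicator {t0..T} t * (gain ratio (rivals t) (R t) - gain ratio (rivals t) (b t)))"
    if "admissible_rate t0 T b" for b
    using set_integral_diff[OF gain_integrable[OF R] gain_integrable[OF that]]
    by (simp_all add: G_def set_lebesgue_integral_def set_integrable_def)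
  have diff_nonneg: "0 \<le> indicator {t0..T} t * (gain ratio (rivals t) (R t) - gain ratio (rivals t) (b t))"
    if "admissible_rate t0 T b" for b t
    using that gain_le_reply[OF ratio_pos rivals_pos, of t "b t"]
    by (auto simp: R_def indicator_def admissible_rate_def)
  have G_le: "G b \<le> G R" if "admissible_rate t0 T b" for b
  proof -
    have "0 \<le> G R - G b"
      unfolding G_diff[OF that] by (intro integral_nonneg_AE AE_I2 diff_nonneg that)
    then show ?thesis by simp
  qed
  have "G b = G R \<longleftrightarrow> (AE t in lborel. t \<in> {t0..T} \<longrightarrow> b t = R t)" if b: "admissible_rate t0 T b" for b
  proof -
    have "G b = G R \<longleftrightarrow> (AE t in lborel. indicator {t0..T} t * (gain ratio (rivals t) (R t) - gain ratio (rivals t) (b t)) = 0)"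
      using integral_nonneg_eq_0_iff_AE[OF diff_integrable[OF b]] diff_nonneg[OF b] G_diff[OF b] by auto
    also have "\<dots> \<longleftrightarrow> (AE t in lborel. t \<in> {t0..T} \<longrightarrow> b t = R t)"
    proof (intro AE_cong)
      fix t
      show "indicator {t0..T} t * (gain ratio (rivals t) (R t) - gain ratio (rivals t) (b t)) = 0 \<longleftrightarrow>
          (t \<in> {t0..T} \<longrightarrow> b t = R t)"
      proof (cases "t \<in> {t0..T} \<and> b t \<noteq> R t")
        case True
        then show ?thesis
          using b gain_less_reply[OF ratio_pos rivals_pos, of t "b t"] by (simp add: R_def admissible_rate_def)
      qed auto
    qed
    finally show ?thesis .
  qed
  then show ?thesis
    unfolding best_response_def is_arg_max_linorder R_def[symmetric]
    using utility_le R G_le by (metis antisym)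
qed

end

section \<open>Individual miners\<close>

lemma has_intensity_mean:
  assumes "has_intensity P F s T N lam" "u \<in> {s..T}" "t \<in> {u..T}" "A \<in> sets (F u)"
  shows "(\<integral>\<^sup>+w\<in>A. of_nat (N t w - N u w) \<partial>P) =
    (\<integral>\<^sup>+w\<in>A. (\<integral>\<^sup>+\<tau>\<in>{u..t}. ennreal (lam \<tau> w) \<partial>lborel) \<partial>P)"
proof -
  have "\<forall>u\<in>{s..T}. \<forall>t\<in>{u..T}. \<forall>A\<in>sets (F u). (\<integral>\<^sup>+w\<in>A. of_nat (N t w - N u w) \<partial>P) =
      (\<integral>\<^sup>+w\<in>A. (\<integral>\<^sup>+\<tau>\<in>{u..t}. ennreal (lam \<tau> w) \<partial>lborel) \<partial>P)"
    using assms(1) unfolding has_intensity_def by (elim conjE)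
  from bspec[OF bspec[OF bspec[OF this assms(2)] assms(3)] assms(4)] show ?thesis .
qed

text \<open>A state-dependent intensity does not determine the law of \<open>N\<close> by itself,
  but testing on the whole space at time \<open>s\<close> still bounds the mean.\<close>

lemma has_intensity_mean_le:
  assumes I: "has_intensity P F s T N lam" and "s \<le> T" "0 \<le> K"
    and le: "\<And>t w. t \<in> {s..T} \<Longrightarrow> w \<in> space P \<Longrightarrow> lam t w \<le> K"
  shows "integrable P (\<lambda>w. real (N T w))" "(\<integral>w. real (N T w) \<partial>P) \<le> K * (T - s)"
proof -
  interpret prob_space P using I by (simp add: has_intensity_def)
  have sub: "subalgebra P (F t)" for t using I by (simp add: has_intensity_def)
  have space: "space P \<in> sets (F s)"
    using sub[of s] sets.top[of "F s"] by (simp add: subalgebra_def)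
  have "(\<integral>\<^sup>+w. ennreal (real (N T w)) \<partial>P) = (\<integral>\<^sup>+w\<in>space P. of_nat (N T w - N s w) \<partial>P)"
    using has_intensity_AE_start[OF I \<open>s \<le> T\<close>] AE_space
    by (intro nn_integral_cong_AE) (elim AE_mp, auto simp: ennreal_of_nat_eq_real_of_nat)
  also have "\<dots> = (\<integral>\<^sup>+w\<in>space P. (\<integral>\<^sup>+\<tau>\<in>{s..T}. ennreal (lam \<tau> w) \<partial>lborel) \<partial>P)"
    using \<open>s \<le> T\<close> by (intro has_intensity_mean[OF I] space) auto
  also have "\<dots> \<le> (\<integral>\<^sup>+w. ennreal (K * (T - s)) \<partial>P)"
  proof (rule nn_integral_mono)
    fix w assume w: "w \<in> space P"
    have "(\<integral>\<^sup>+\<tau>\<in>{s..T}. ennreal (lam \<tau> w) \<partial>lborel) \<le> (\<integral>\<^sup>+\<tau>\<in>{s..T}. ennreal K \<partial>lborel)"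
      using le[OF _ w] by (intro nn_integral_mono) (auto simp: indicator_def intro: ennreal_leI)
    also have "\<dots> = ennreal (K * (T - s))"
      using \<open>s \<le> T\<close> \<open>0 \<le> K\<close> by (simp add: nn_integral_cmult_indicator ennreal_mult)
    finally show "(\<integral>\<^sup>+\<tau>\<in>{s..T}. ennreal (lam \<tau> w) \<partial>lborel) * indicator (space P) w \<le> ennreal (K * (T - s))"
      using w by simp
  qed
  also have "\<dots> = ennreal (K * (T - s))" by (simp add: emeasure_space_1)
  finally have bound: "(\<integral>\<^sup>+w. ennreal (real (N T w)) \<partial>P) \<le> ennreal (K * (T - s))" .
  have "N T \<in> measurable (F T) (count_space UNIV)"
    using I \<open>s \<le> T\<close> by (simp add: has_intensity_def counting_process_def)
  then have [measurable]: "N T \<in> measurable P (count_space UNIV)"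
    by (rule measurable_from_subalg[OF sub])
  show int: "integrable P (\<lambda>w. real (N T w))"
    using bound by (intro integrableI_nonneg) (auto simp: less_top[symmetric] top_unique)
  have "ennreal (\<integral>w. real (N T w) \<partial>P) \<le> ennreal (K * (T - s))"
    using bound int by (simp add: nn_integral_eq_integral)
  then show "(\<integral>w. real (N T w) \<partial>P) \<le> K * (T - s)"
    using \<open>0 \<le> K\<close> \<open>s \<le> T\<close> by simp
qed

lemma wealth_process_terminal:
  assumes "wealth_process K c r L s T \<alpha> P F N X" "s \<le> T"
  shows "AE w in P. X T w = X s w - c * (LINT u:{s..T}|lborel. \<alpha> u (X u w)) + r * real (N T w)"
proof -
  have "AE w in P. set_integrable lborel {s..T} (\<lambda>u. \<alpha> u (X u w)) \<and>
      (\<forall>t\<in>{s..T}. X t w = X s w - c * (LINT u:{s..t}|lborel. \<alpha> u (X u w)) + r * real (N t w))"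
    using assms(1) unfolding wealth_process_def by blast
  then show ?thesis
  proof eventually_elim
    case (elim w)
    show ?case by (rule bspec[OF conjunct2[OF elim]]) (use assms(2) in simp)
  qed
qed

text \<open>The shifted feedback applied to the shifted wealth produces the same hash rates along
  each path, so the counting process and its intensity stay as they are.\<close>

lemma wealth_process_translate:
  assumes "wealth_process K c r L s T \<alpha> P F N X"
  shows "wealth_process K c r L s T (\<lambda>t x. \<alpha> t (x - y)) P F N (\<lambda>t w. X t w + y)"
proof -
  let ?R = "restrict_space borel ({s..T} \<times> UNIV) :: (real \<times> real) measure"
  have "(\<lambda>z. (fst z, snd z - y)) \<in> measurable ?R ?R"
    by (intro measurable_restrict_space3 borel_measurable_continuous_onI continuous_intros) auto
  from measurable_compose[OF this, of "\<lambda>(t, x). \<alpha> t x" borel]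
  have "(\<lambda>(t, x). \<alpha> t (x - y)) \<in> borel_measurable ?R"
    using assms by (simp add: wealth_process_def split_beta')
  moreover have "progressively_measurable F s T (\<lambda>t w. X t w + y)"
    using assms by (auto simp: wealth_process_def progressively_measurable_def split_beta'
      intro!: borel_measurable_add)
  ultimately show ?thesis
    using assms by (simp add: wealth_process_def algebra_simps)
qed

text \<open>Never mining, on a one-point law: the intensity is 0 for every \<open>L\<close>,
  including \<open>L t = 0\<close> by division by zero. It shows that the supremum ranges over a
  nonempty set.\<close>

lemma wealth_process_idle:
  fixes x :: real and f :: "real \<Rightarrow> real"
  obtains \<alpha> and P :: "sample measure" and F N X where
    "wealth_process K c r L s T \<alpha> P F N X" "AE w in P. X s w = x" "integrable P (\<lambda>w. f (X T w))"
proof -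
  define P :: "sample measure" where "P = return (count_space UNIV) (\<lambda>_. 0)"
  interpret prob_space P unfolding P_def by (rule prob_space_return) simp
  have "filtration (space P) (\<lambda>_::real. P)" by standard auto
  then have "has_intensity P (\<lambda>_. P) s T (\<lambda>_ _. 0) (\<lambda>_ _. 0)"
    by (auto simp: has_intensity_def counting_process_def progressively_measurable_def prob_space_axioms
      subalgebra_def intro!: exI[of _ "{}"])
  then have "wealth_process K c r L s T (\<lambda>_ _. 0) P (\<lambda>_. P) (\<lambda>_ _. 0) (\<lambda>_ _. x)"
    by (auto simp: wealth_process_def progressively_measurable_def set_integrable_def)
  then show ?thesis by (rule that) auto
qed

lemma exp_utility_add:
  "exp_utility \<gamma> (x + y) = exp (- \<gamma> * y) * exp_utility \<gamma> x + (if \<gamma> = 0 then y else 0)"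
proof -
  have "exp (- \<gamma> * (x + y)) = exp (- \<gamma> * y) * exp (- \<gamma> * x)"
    unfolding exp_add[symmetric] by (simp add: distrib_left)
  then show ?thesis unfolding exp_utility_def by simp
qed

section \<open>Translation equivariance of the value function\<close>

definition payoffs ::
    "real \<Rightarrow> real \<Rightarrow> real \<Rightarrow> real \<Rightarrow> (real \<Rightarrow> real) \<Rightarrow> (real \<Rightarrow> real) \<Rightarrow> real \<Rightarrow> real \<Rightarrow> real set" where
  "payoffs K c r T U L t x =
     {(\<integral>w. U (X T w) \<partial>P) | \<alpha> (P :: sample measure) F N X.
        wealth_process K c r L t T \<alpha> P F N X \<and> (AE w in P. X t w = x) \<and> integrable P (\<lambda>w. U (X T w))}"

lemma value_function_eq_Sup_payoffs: "value_function K c r T U L t x = Sup (payoffs K c r T U L t x)"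
  by (simp add: value_function_def payoffs_def)

lemma payoffs_nonempty: "payoffs K c r T U L t x \<noteq> {}"
proof (rule wealth_process_idle[of K c r L t T x U])
  fix \<alpha> and P :: "sample measure" and F N X
  assume "wealth_process K c r L t T \<alpha> P F N X" "AE w in P. X t w = x" "integrable P (\<lambda>w. U (X T w))"
  then have "(\<integral>w. U (X T w) \<partial>P) \<in> payoffs K c r T U L t x"
    unfolding payoffs_def by blast
  then show ?thesis by blast
qed

lemma payoffs_translate:
  assumes "u \<in> payoffs K c r T (exp_utility \<gamma>) L t x"
  shows "exp (- \<gamma> * y) * u + (if \<gamma> = 0 then y else 0) \<in> payoffs K c r T (exp_utility \<gamma>) L t (x + y)"
proof -
  obtain \<alpha> and P :: "sample measure" and F N X where
    wp: "wealth_process K c r L t T \<alpha> P F N X" and start: "AE w in P. X t w = x"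
    and int: "integrable P (\<lambda>w. exp_utility \<gamma> (X T w))" and u: "u = (\<integral>w. exp_utility \<gamma> (X T w) \<partial>P)"
    using assms unfolding payoffs_def by blast
  interpret prob_space P using wp by (simp add: wealth_process_def has_intensity_def)
  have "(\<integral>w. exp_utility \<gamma> (X T w + y) \<partial>P) = exp (- \<gamma> * y) * u + (if \<gamma> = 0 then y else 0)"
    "integrable P (\<lambda>w. exp_utility \<gamma> (X T w + y))"
    using int unfolding exp_utility_add by (simp_all add: u prob_space)
  moreover have "AE w in P. X t w + y = x + y" using start by simp
  ultimately show ?thesis
    using wealth_process_translate[OF wp, of y] unfolding payoffs_def by (intro CollectI) metis
qed

text \<open>A bound is required for \<open>Sup\<close> on the reals to be a genuine supremum.
  Exponential utility is negative; in the risk-neutral case costs only lower the wealth, and rewards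
  arrive at intensity at most \<open>K\<close>.\<close>

lemma payoffs_bdd_above:
  assumes "0 < K" "0 < c" "0 < r" "0 \<le> \<gamma>" "t \<le> T" and L: "\<And>\<tau>. \<tau> \<in> {t..T} \<Longrightarrow> 0 \<le> L \<tau>"
  shows "bdd_above (payoffs K c r T (exp_utility \<gamma>) L t x)"
proof (cases "\<gamma> = 0")
  case False
  have "u \<le> 0" if u: "u \<in> payoffs K c r T (exp_utility \<gamma>) L t x" for u
  proof -
    obtain P :: "sample measure" and X where "u = (\<integral>w. exp_utility \<gamma> (X T w) \<partial>P)"
      using u unfolding payoffs_def by blast
    moreover have "0 \<le> (\<integral>w. - exp_utility \<gamma> (X T w) \<partial>P)"
      using assms(4) by (intro integral_nonneg_AE) (simp add: exp_utility_def False)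
    ultimately show ?thesis by simp
  qed
  then show ?thesis by (rule bdd_aboveI)
next
  case True
  have "u \<le> x + r * (K * (T - t))" if "u \<in> payoffs K c r T (exp_utility \<gamma>) L t x" for u
  proof -
    obtain \<alpha> and P :: "sample measure" and F N X where
      wp: "wealth_process K c r L t T \<alpha> P F N X" and start: "AE w in P. X t w = x"
      and int: "integrable P (\<lambda>w. exp_utility \<gamma> (X T w))" and u: "u = (\<integral>w. exp_utility \<gamma> (X T w) \<partial>P)"
      using \<open>u \<in> _\<close> unfolding payoffs_def by blast
    interpret prob_space P using wp by (simp add: wealth_process_def has_intensity_def)
    have nonneg: "0 \<le> \<alpha> \<tau> z" if "\<tau> \<in> {t..T}" for \<tau> z using wp that by (simp add: wealth_process_def)
    have rate: "K * \<alpha> \<tau> z / (\<alpha> \<tau> z + L \<tau>) \<le> K" if "\<tau> \<in> {t..T}" for \<tau> z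
    proof (cases "\<alpha> \<tau> z + L \<tau> = 0")
      case False
      then have "0 < \<alpha> \<tau> z + L \<tau>" using nonneg[OF that, of z] L[OF that] by linarith
      then show ?thesis using L[OF that] \<open>0 < K\<close> by (simp add: divide_le_eq distrib_left)
    qed (use \<open>0 < K\<close> in simp)
    have I: "has_intensity P F t T N (\<lambda>\<tau> w. K * \<alpha> \<tau> (X \<tau> w) / (\<alpha> \<tau> (X \<tau> w) + L \<tau>))"
      using wp by (simp add: wealth_process_def)
    note mean = has_intensity_mean_le[OF I \<open>t \<le> T\<close> less_imp_le[OF \<open>0 < K\<close>] rate]
    have "AE w in P. X T w = X t w - c * (LINT \<tau>:{t..T}|lborel. \<alpha> \<tau> (X \<tau> w)) + r * real (N T w)"
      using wp \<open>t \<le> T\<close> by (rule wealth_process_terminal)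
    then have "AE w in P. X T w \<le> x + r * real (N T w)"
      using start
    proof eventually_elim
      case (elim w)
      have "0 \<le> (LINT \<tau>:{t..T}|lborel. \<alpha> \<tau> (X \<tau> w))"
        unfolding set_lebesgue_integral_def
        by (intro integral_nonneg_AE AE_I2) (auto simp: indicator_def nonneg)
      then show ?case using elim \<open>0 < c\<close> by simp
    qed
    then have "u \<le> (\<integral>w. x + r * real (N T w) \<partial>P)"
      unfolding u using int mean(1) True by (intro integral_mono_AE) (auto simp: exp_utility_def)
    also have "\<dots> = x + r * (\<integral>w. real (N T w) \<partial>P)"
      using mean(1) by (simp add: prob_space)
    also have "\<dots> \<le> x + r * (K * (T - t))"
      using mean(2) \<open>0 < r\<close> by simp
    finally show ?thesis .
  qed
  then show ?thesis by (rule bdd_aboveI)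
qed

text \<open>
  Exponential utility makes the problem equivariant under translations of the wealth, so the
  dependence of the value function on the wealth is explicit without solving the HJB equation.
\<close>

lemma value_function_translate:
  assumes "0 < K" "0 < c" "0 < r" "0 \<le> \<gamma>" "t \<le> T" "\<And>\<tau>. \<tau> \<in> {t..T} \<Longrightarrow> 0 \<le> L \<tau>"
  defines "v \<equiv> value_function K c r T (exp_utility \<gamma>) L t"
  shows "v (x + y) = exp (- \<gamma> * y) * v x + (if \<gamma> = 0 then y else 0)"
proof -
  note bdd = payoffs_bdd_above[where x=z for z, OF assms(1-6)]
  have ge: "exp (- \<gamma> * y) * v x + (if \<gamma> = 0 then y else 0) \<le> v (x + y)" for x y
  proof -
    let ?b = "if \<gamma> = 0 then y else 0"
    have "v x \<le> (v (x + y) - ?b) / exp (- \<gamma> * y)"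
      unfolding v_def value_function_eq_Sup_payoffs
    proof (rule cSup_least[OF payoffs_nonempty])
      fix u assume "u \<in> payoffs K c r T (exp_utility \<gamma>) L t x"
      from cSup_upper[OF payoffs_translate[OF this, of y] bdd]
      show "u \<le> (Sup (payoffs K c r T (exp_utility \<gamma>) L t (x + y)) - ?b) / exp (- \<gamma> * y)"
        by (simp only: pos_le_divide_eq[OF exp_gt_zero]) (simp add: mult.commute le_diff_eq)
    qed
    then show ?thesis by (simp only: pos_le_divide_eq[OF exp_gt_zero]) (simp add: mult.commute le_diff_eq)
  qed
  have "v (x + y) \<le> exp (- \<gamma> * y) * v x + (if \<gamma> = 0 then y else 0)"
  proof -
    \<comment> \<open>The reverse inequality is the one already shown, applied to the translation by
      \<open>- y\<close> from \<open>x + y\<close>.\<close>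
    have "exp (- \<gamma> * y) * (exp (\<gamma> * y) * v (x + y) + (if \<gamma> = 0 then - y else 0)) \<le> exp (- \<gamma> * y) * v x"
      using ge[of "- y" "x + y"] by (intro mult_left_mono) auto
    then show ?thesis by (simp add: distrib_left mult.assoc[symmetric] exp_add[symmetric] split: if_splits)
  qed
  then show ?thesis using ge by (rule antisym)
qed

section \<open>Optimal hash rate and Hamiltonian of an individual miner\<close>

locale individual_miner =
  fixes K c r \<gamma> t0 T :: real and L :: "real \<Rightarrow> real"
  assumes K_pos: "0 < K" and c_pos: "0 < c" and r_pos: "0 < r" and \<gamma>_nonneg: "0 \<le> \<gamma>"
    and L_nonneg: "t \<in> {t0..T} \<Longrightarrow> 0 \<le> L t"
    and value_mono: "t \<in> {t0..T} \<Longrightarrow> strict_mono (value_function K c r T (exp_utility \<gamma>) L t)"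
begin

abbreviation v where
  "v \<equiv> value_function K c r T (exp_utility \<gamma>) L"

definition threshold :: real where
  "threshold = K * reward_weight r \<gamma> / c"

definition marginal :: "real \<Rightarrow> real \<Rightarrow> real" where
  "marginal t x = (if \<gamma> = 0 then 1 else - \<gamma> * exp (- \<gamma> * x) * v t 0)"

lemma value_eq:
  assumes "t \<in> {t0..T}"
  shows "v t x = exp (- \<gamma> * x) * v t 0 + (if \<gamma> = 0 then x else 0)"
  using value_function_translate[OF K_pos c_pos r_pos \<gamma>_nonneg, of t T L 0 x] assms L_nonneg by simp

lemma value_derivative:
  assumes "t \<in> {t0..T}"
  shows "(v t has_real_derivative marginal t x) (at x)"
proof -
  have "((\<lambda>x. exp (- \<gamma> * x) * v t 0 + (if \<gamma> = 0 then x else 0)) has_real_derivative marginal t x) (at x)"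
    unfolding marginal_def by (cases "\<gamma> = 0") (auto intro!: derivative_eq_intros)
  then show ?thesis by (simp only: value_eq[OF assms, symmetric])
qed

text \<open>For positive \<open>\<gamma>\<close> the value is \<open>v t 0\<close> times a
  decreasing exponential, so strict monotonicity forces \<open>v t 0 < 0\<close>.\<close>

lemma marginal_pos:
  assumes "t \<in> {t0..T}"
  shows "0 < marginal t x"
proof (cases "\<gamma> = 0")
  case False
  then have "0 < \<gamma>" using \<gamma>_nonneg by simp
  have "v t 0 < v t 1" using value_mono[OF assms] by (simp add: strict_mono_less)
  then have "0 < (exp (- \<gamma>) - 1) * v t 0"
    using value_eq[OF assms, of 1] False by (simp add: left_diff_distrib)
  moreover have "exp (- \<gamma>) - 1 < 0" using \<open>0 < \<gamma>\<close> by simp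
  ultimately have "v t 0 < 0" by (simp only: zero_less_mult_iff) auto
  then show ?thesis using \<open>0 < \<gamma>\<close> by (simp add: marginal_def mult_pos_neg)
next
  case True
  then have "marginal t x = 1" unfolding marginal_def by (rule if_P)
  then show ?thesis by (simp only: zero_less_one)
qed

lemma value_increment:
  assumes "t \<in> {t0..T}"
  shows "v t (x + r) - v t x = reward_weight r \<gamma> * marginal t x"
proof (cases "\<gamma> = 0")
  case True
  then have "marginal t x = 1" unfolding marginal_def by (rule if_P)
  moreover have "reward_weight r \<gamma> = r" "exp (- \<gamma> * z) = 1" for z
    by (simp_all add: True reward_weight_def)
  ultimately show ?thesis
    unfolding value_eq[OF assms, of "x + r"] value_eq[OF assms, of x] using True by (simp only: if_True) simp
next
  case False
  have exp_r: "exp (- \<gamma> * (x + r)) = exp (- \<gamma> * x) * exp (- \<gamma> * r)"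
    unfolding exp_add[symmetric] by (simp add: distrib_left)
  have "reward_weight r \<gamma> * \<gamma> = 1 - exp (- \<gamma> * r)"
    using False by (simp add: reward_weight_def)
  moreover have "marginal t x = - \<gamma> * exp (- \<gamma> * x) * v t 0"
    unfolding marginal_def using False by (rule if_not_P)
  then have "reward_weight r \<gamma> * marginal t x = - (reward_weight r \<gamma> * \<gamma>) * exp (- \<gamma> * x) * v t 0"
    by (simp only:) simp
  ultimately have "reward_weight r \<gamma> * marginal t x = - (1 - exp (- \<gamma> * r)) * exp (- \<gamma> * x) * v t 0"
    by (simp only:)
  then show ?thesis
    unfolding value_eq[OF assms, of "x + r"] value_eq[OF assms, of x] exp_r using False
    by (simp add: algebra_simps)
qed

lemma threshold_pos: "0 < threshold"
  using reward_weight_pos[OF \<gamma>_nonneg r_pos] K_pos c_pos by (simp add: threshold_def)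

lemma optimal_hash_rate_eq:
  assumes "t \<in> {t0..T}"
  shows "optimal_hash_rate K c r T (exp_utility \<gamma>) L t x =
    (if L t < threshold then - L t + sqrt (L t * threshold) else 0)"
proof -
  have "K * (v t (x + r) - v t x) / (c * deriv (v t) x) = threshold"
    using marginal_pos[OF assms, of x]
    by (simp add: value_increment[OF assms] DERIV_imp_deriv[OF value_derivative[OF assms]] threshold_def)
  then show ?thesis by (simp only: optimal_hash_rate_def Let_def)
qed

text \<open>With \<open>p\<close> and \<open>l\<close> the square roots of \<open>threshold\<close>
  and \<open>L t\<close>, the bracket completes to a square that vanishes at
  \<open>a = p * l - l * l\<close>, which is positive because \<open>l < p\<close>. The closed form
  makes it possible to read \<open>L t\<close> off the HJB equation.\<close>

lemma hamiltonian_eq: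
  assumes t: "t \<in> {t0..T}" and L: "0 < L t" "L t < threshold"
  shows "(SUP a\<in>{0..}. - c * a * marginal t x + K * a / (a + L t) * (v t (x + r) - v t x)) =
    c * marginal t x * (sqrt threshold - sqrt (L t))\<^sup>2"
proof -
  define p where "p = sqrt threshold"
  define l where "l = sqrt (L t)"
  have pl: "0 < l" "l < p" "p * p = threshold" "l * l = L t"
    using L threshold_pos by (auto simp: p_def l_def)
  let ?H = "\<lambda>a. - c * a * marginal t x + K * a / (a + L t) * (v t (x + r) - v t x)"
  have H: "?H a = c * marginal t x * ((p - l)\<^sup>2 - (a + l * l - p * l)\<^sup>2 / (a + l * l))" if "0 \<le> a" for a
  proof -
    have pos: "0 < a + l * l" using that pl(1) by (simp add: add_nonneg_pos)
    have Kw: "K * reward_weight r \<gamma> = c * (p * p)" using c_pos by (simp add: pl threshold_def)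
    have "?H a = K * reward_weight r \<gamma> * (marginal t x * (a / (a + l * l))) - c * a * marginal t x"
      unfolding value_increment[OF t] pl(4)[symmetric] by simp
    also have "\<dots> = c * marginal t x * (p * p * a / (a + l * l) - a)"
      unfolding Kw by (simp add: right_diff_distrib mult_ac)
    also have "p * p * a / (a + l * l) - a = (p * p * a - a * (a + l * l)) / (a + l * l)"
      using pos by (simp add: diff_divide_distrib)
    also have "p * p * a - a * (a + l * l) = (p - l)\<^sup>2 * (a + l * l) - (a + l * l - p * l)\<^sup>2"
      by (simp add: algebra_simps power2_eq_square)
    also have "\<dots> / (a + l * l) = (p - l)\<^sup>2 - (a + l * l - p * l)\<^sup>2 / (a + l * l)"
      using pos by (simp add: diff_divide_distrib)
    finally show ?thesis .
  qed
  have cm: "0 < c * marginal t x" using marginal_pos[OF t] c_pos by simp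
  have "(SUP a\<in>{0..}. ?H a) = c * marginal t x * (p - l)\<^sup>2"
  proof (rule cSup_eq_maximum)
    have "0 \<le> p * l - l * l" using pl(1,2) by (simp add: mult_right_mono)
    from H[OF this] have "c * marginal t x * (p - l)\<^sup>2 = ?H (p * l - l * l)" by simp
    with \<open>0 \<le> p * l - l * l\<close> show "c * marginal t x * (p - l)\<^sup>2 \<in> ?H ` {0..}" by blast
  next
    fix h assume "h \<in> ?H ` {0..}"
    then obtain a where a: "0 \<le> a" "h = ?H a" by auto
    have "0 \<le> (a + l * l - p * l)\<^sup>2 / (a + l * l)" using a(1) by simp
    then show "h \<le> c * marginal t x * (p - l)\<^sup>2"
      unfolding a(2) H[OF a(1)] using cm by (intro mult_left_mono) auto
  qed
  then show ?thesis by (simp add: p_def l_def)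
qed

text \<open>
  The HJB equation is needed only here: it forces the competitors' hash rate, which the best
  response determines only almost everywhere, to be continuous.
\<close>

lemma competitors_continuous:
  assumes sol: "classical_solution K c r t0 T (exp_utility \<gamma>) L v"
    and L: "\<And>t. t \<in> {t0..T} \<Longrightarrow> 0 < L t \<and> L t < threshold"
  shows "continuous_on {t0..T} L"
proof -
  obtain vt vx where cont: "continuous_on ({t0..T} \<times> UNIV) (\<lambda>(t, x). vt t x)"
      "continuous_on ({t0..T} \<times> UNIV) (\<lambda>(t, x). vx t x)"
    and vx: "\<And>t x. t \<in> {t0..T} \<Longrightarrow> ((\<lambda>y. v t y) has_real_derivative vx t x) (at x)"
    and hjb: "\<And>t x. t \<in> {t0..T} \<Longrightarrow> vt t x + (SUP a\<in>{0..}. - c * a * vx t x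
                       + K * a / (a + L t) * (v t (x + r) - v t x)) = 0"
    using sol unfolding classical_solution_def by blast
  have vx_eq: "vx t x = marginal t x" if "t \<in> {t0..T}" for t x
    using vx[OF that] value_derivative[OF that] by (rule DERIV_unique)
  have slice: "continuous_on {t0..T} (\<lambda>t. f t 0)"
    if "continuous_on ({t0..T} \<times> UNIV) (\<lambda>(t, x). f t x)" for f :: "real \<Rightarrow> real \<Rightarrow> real"
  proof -
    have "continuous_on {t0..T} (\<lambda>t. case (t, 0) of (t, x) \<Rightarrow> f t x)"
      by (rule continuous_on_compose2[OF that]) (auto intro!: continuous_intros)
    then show ?thesis by simp
  qed
  \<comment> \<open>Since \<open>L t < threshold\<close>, the difference of the square roots is
    positive and is recovered from its square; this expresses \<open>L t\<close> by continuous
    functions of time.\<close>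
  have L_eq: "L t = (sqrt threshold - sqrt (- vt t 0 / (c * vx t 0)))\<^sup>2" if t: "t \<in> {t0..T}" for t
  proof -
    have pos: "0 < c * vx t 0" using marginal_pos[OF t] c_pos by (simp add: vx_eq[OF t])
    have "vt t 0 + c * vx t 0 * (sqrt threshold - sqrt (L t))\<^sup>2 = 0"
      using hjb[OF t, of 0] hamiltonian_eq[OF t, of 0] L[OF t] by (simp add: vx_eq[OF t])
    then have "- vt t 0 = c * vx t 0 * (sqrt threshold - sqrt (L t))\<^sup>2" by linarith
    then have "- vt t 0 / (c * vx t 0) = (sqrt threshold - sqrt (L t))\<^sup>2"
      using pos by (simp only: nonzero_mult_div_cancel_left)
    then have "sqrt (- vt t 0 / (c * vx t 0)) = sqrt threshold - sqrt (L t)"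
      using L[OF t] by simp
    then show ?thesis using L[OF t] by simp
  qed
  have "continuous_on {t0..T} (\<lambda>t. (sqrt threshold - sqrt (- vt t 0 / (c * vx t 0)))\<^sup>2)"
    using marginal_pos c_pos
    by (intro continuous_intros slice cont) (metis vx_eq less_irrefl mult_pos_pos)
  then show ?thesis by (rule continuous_on_eq) (rule L_eq[symmetric])
qed

end

section \<open>Wealth density\<close>

lemma (in poisson_sample) distr_init: "distr P borel (\<lambda>w. w 0) = init"
proof -
  have "distr P (coordinate 0) (\<lambda>w. w 0) = coordinate 0"
    unfolding P_def by (rule distr_PiM_component) (simp_all add: prob_coordinate)
  moreover have "distr P (coordinate 0) (\<lambda>w. w 0) = distr P borel (\<lambda>w. w 0)"
    by (rule distr_cong) (simp_all add: sets_coordinate)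
  ultimately show ?thesis by (simp add: coordinate_def)
qed

text \<open>A constant hash rate against a constant success rate makes the intensity deterministic,
  so the wealth can be written down on the Poisson sample without solving a stochastic
  equation.\<close>

lemma wealth_density_exists:
  fixes m\<^sub>0 :: "real \<Rightarrow> real"
  assumes m0: "\<And>x. 0 \<le> m\<^sub>0 x" "has_bochner_integral lborel m\<^sub>0 1" and "t0 \<le> T"
    and a: "0 \<le> a" "\<And>t x. t \<in> {t0..T} \<Longrightarrow> \<alpha> t x = a"
    and rate: "0 \<le> \<rho>" "\<And>t. t \<in> {t0..T} \<Longrightarrow> K * a / (a + L t) = \<rho>"
  obtains m where "wealth_density K c r L t0 T m\<^sub>0 \<alpha> m"
proof -
  have [measurable]: "m\<^sub>0 \<in> borel_measurable borel"
    using borel_measurable_has_bochner_integral[OF m0(2)] by simp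
  have m0_1: "(\<integral>\<^sup>+x. ennreal (m\<^sub>0 x) \<partial>lborel) = 1"
    using m0 by (simp add: has_bochner_integral_iff nn_integral_eq_integral)
  define init where "init = density lborel (\<lambda>x. ennreal (m\<^sub>0 x))"
  have prob_init: "prob_space init"
    by (rule prob_spaceI) (simp add: init_def emeasure_density m0_1)
  have sets_init: "sets init = sets borel" by (simp add: init_def)
  have nn_integral_init: "(\<integral>\<^sup>+y. f y \<partial>init) = (\<integral>\<^sup>+y. ennreal (m\<^sub>0 y) * f y \<partial>lborel)"
    if "f \<in> borel_measurable borel" for f
    unfolding init_def by (rule nn_integral_density) (use that in simp_all)
  interpret poisson_sample init "\<lambda>_. \<rho>" t0 T
  proof (rule poisson_sample.intro)
    show "integrable lborel (\<lambda>t. \<rho> * indicator {t0..T} t)"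
      using borel_integrable_atLeastAtMost'[of t0 T "\<lambda>_. \<rho>"] by (simp add: set_integrable_def mult.commute)
  qed (use prob_init sets_init rate(1) in auto)
  interpret prob_space P by (rule prob_P)
  interpret lborel_P: pair_sigma_finite lborel P ..
  define X where "X t w = w 0 - c * (a * (t - t0)) + r * real (N t w)" for t w
  \<comment> \<open>The initial density translated by the cost and the random reward, averaged over
    the number of rewards.\<close>
  define g where "g t x = (\<integral>\<^sup>+w. ennreal (m\<^sub>0 (x + c * (a * (t - t0)) - r * real (N t w))) \<partial>P)" for t x
  have X_measurable [measurable]: "X t \<in> borel_measurable P" for t
    unfolding X_def by measurable
  have X_progressive: "progressively_measurable F t0 T X"
    unfolding progressively_measurable_def
  proof
    fix t assume t: "t \<in> {t0..T}"
    let ?M = "restrict_space borel {t0..t} \<Otimes>\<^sub>M F t"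
    have "(\<lambda>(u, w). real (N u w)) \<in> borel_measurable ?M"
      using N_progressive t unfolding progressively_measurable_def by blast
    moreover have "(\<lambda>z. snd z 0) \<in> borel_measurable ?M"
      by (rule measurable_compose[OF measurable_snd init_adapted])
    moreover have "(\<lambda>u. u) \<in> borel_measurable (restrict_space borel {t0..t})"
      by (rule measurable_restrict_space1) simp
    then have "fst \<in> borel_measurable ?M"
      using measurable_compose[OF measurable_fst] by blast
    ultimately show "(\<lambda>(u, w). X u w) \<in> borel_measurable ?M"
      unfolding X_def split_beta' by measurable
  qed
  have intensity: "has_intensity P F t0 T N (\<lambda>t w. K * \<alpha> t (X t w) / (\<alpha> t (X t w) + L t))"
    using has_intensity_N by (rule has_intensity_cong) (simp add: a(2) rate(2))
  \<comment> \<open>\<open>N t0\<close> vanishes only almost surely, so the initial wealth is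
    coordinate 0 up to a null set.\<close>
  have X_start: "AE w in P. X t0 w = w 0"
    using has_intensity_AE_start[OF has_intensity_N \<open>t0 \<le> T\<close>] by eventually_elim (simp add: X_def)
  have "wealth_process K c r L t0 T \<alpha> P F N X"
    unfolding wealth_process_def
  proof (intro conjI ballI allI X_progressive intensity)
    show "(\<lambda>(t, x). \<alpha> t x) \<in> borel_measurable (restrict_space borel ({t0..T} \<times> UNIV))"
      by (subst measurable_cong[of _ _ "\<lambda>_. a"]) (auto simp: space_restrict_space a)
    show "0 \<le> \<alpha> t x" if "t \<in> {t0..T}" for t x using that a by simp
    have int: "set_integrable lborel {t0..T} (\<lambda>u. \<alpha> u (X u w))" for w
    proof -
      have "(\<lambda>u. indicator {t0..T} u *\<^sub>R \<alpha> u (X u w)) = (\<lambda>u. indicator {t0..T} u *\<^sub>R a)"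
        by (auto simp: indicator_def a)
      then show ?thesis
        using borel_integrable_atLeastAtMost'[of t0 T "\<lambda>_. a"] by (simp add: set_integrable_def)
    qed
    have "(LINT u:{t0..t}|lborel. \<alpha> u (X u w)) = a * (t - t0)" if "t \<in> {t0..T}" for t w
    proof -
      have "(LINT u:{t0..t}|lborel. \<alpha> u (X u w)) = (LINT u:{t0..t}|lborel. a)"
        using that by (intro set_lebesgue_integral_cong) (auto simp: a)
      also have "\<dots> = a * (t - t0)"
        using that by (simp add: set_lebesgue_integral_def mult.commute)
      finally show ?thesis .
    qed
    moreover have "X t w = X t0 w - c * (a * (t - t0)) + r * real (N t w)" if "X t0 w = w 0" for t w
      unfolding that by (simp add: X_def)
    ultimately show "AE w in P. set_integrable lborel {t0..T} (\<lambda>u. \<alpha> u (X u w)) \<and>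
        (\<forall>t\<in>{t0..T}. X t w = X t0 w - c * (LINT u:{t0..t}|lborel. \<alpha> u (X u w)) + r * real (N t w))"
      using X_start int by (auto elim!: eventually_mono)
  qed
  moreover have "distributed P lborel (X t0) (\<lambda>x. ennreal (m\<^sub>0 x))"
  proof -
    have "distr P lborel (X t0) = distr P borel (\<lambda>w. w 0)"
      using X_start by (intro distr_cong_AE) auto
    also have "\<dots> = init" by (rule distr_init)
    also have "\<dots> = density lborel (\<lambda>x. ennreal (m\<^sub>0 x))" by (rule init_def)
    finally show ?thesis by (simp add: distributed_def)
  qed
  moreover have "distributed P lborel (X t) (\<lambda>x. ennreal (enn2real (g t x)))" for t
  proof -
    have shift_measurable [measurable]: "(\<lambda>z. f (fst z + k - r * real (N t (snd z)))) \<in> borel_measurable (lborel \<Otimes>\<^sub>M P)"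
      if [measurable]: "f \<in> borel_measurable borel" for f :: "real \<Rightarrow> ennreal" and k
      by measurable
    have g_measurable [measurable]: "g t \<in> borel_measurable borel"
      unfolding g_def using shift_measurable[of "\<lambda>x. ennreal (m\<^sub>0 x)" "c * (a * (t - t0))"]
      by (intro borel_measurable_nn_integral) (simp_all add: split_beta')
    have distr: "distr P lborel (X t) = density lborel (g t)"
    proof (rule measure_eqI)
      fix B assume "B \<in> sets (distr P lborel (X t))"
      then have B [measurable]: "B \<in> sets borel" by simp
      let ?d = "\<lambda>w. - c * (a * (t - t0)) + r * real (N t w)"
      have X_eq: "X t w = w 0 + ?d w" for w by (simp add: X_def)
      have "emeasure (distr P lborel (X t)) B = (\<integral>\<^sup>+w. indicator B (X t w) \<partial>P)"
        by (subst nn_integral_indicator[symmetric], simp, subst nn_integral_distr) auto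
      also have "\<dots> = (\<integral>\<^sup>+y. (\<integral>\<^sup>+w. indicator B (y + ?d w) \<partial>P) \<partial>init)"
        unfolding X_eq
        by (rule nn_integral_init_N[of "\<lambda>y n. indicator B (y + (- c * (a * (t - t0)) + r * real n))"]) measurable
      also have "\<dots> = (\<integral>\<^sup>+y. (\<integral>\<^sup>+w. ennreal (m\<^sub>0 y) * indicator B (y + ?d w) \<partial>P) \<partial>lborel)"
      proof -
        have "(\<integral>\<^sup>+y. (\<integral>\<^sup>+w. indicator B (y + ?d w) \<partial>P) \<partial>init) =
            (\<integral>\<^sup>+y. ennreal (m\<^sub>0 y) * (\<integral>\<^sup>+w. indicator B (y + ?d w) \<partial>P) \<partial>lborel)"
          by (rule nn_integral_init) measurable
        also have "\<dots> = (\<integral>\<^sup>+y. (\<integral>\<^sup>+w. ennreal (m\<^sub>0 y) * indicator B (y + ?d w) \<partial>P) \<partial>lborel)"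
          by (intro nn_integral_cong nn_integral_cmult[symmetric]) measurable
        finally show ?thesis .
      qed
      also have "\<dots> = (\<integral>\<^sup>+w. (\<integral>\<^sup>+y. ennreal (m\<^sub>0 y) * indicator B (y + ?d w) \<partial>lborel) \<partial>P)"
        by (rule lborel_P.Fubini'[symmetric]) measurable
      also have "\<dots> = (\<integral>\<^sup>+w. (\<integral>\<^sup>+x. ennreal (m\<^sub>0 (x - ?d w)) * indicator B x \<partial>lborel) \<partial>P)"
      proof (rule nn_integral_cong)
        fix w
        show "(\<integral>\<^sup>+y. ennreal (m\<^sub>0 y) * indicator B (y + ?d w) \<partial>lborel) =
            (\<integral>\<^sup>+x. ennreal (m\<^sub>0 (x - ?d w)) * indicator B x \<partial>lborel)"
          by (subst nn_integral_real_affine[where c=1 and t="- ?d w"]) (auto simp: algebra_simps)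
      qed
      also have "\<dots> = (\<integral>\<^sup>+x. (\<integral>\<^sup>+w. ennreal (m\<^sub>0 (x - ?d w)) * indicator B x \<partial>P) \<partial>lborel)"
        by (rule lborel_P.Fubini') measurable
      also have "\<dots> = (\<integral>\<^sup>+x. g t x * indicator B x \<partial>lborel)"
      proof (rule nn_integral_cong)
        fix x
        have "(\<integral>\<^sup>+w. ennreal (m\<^sub>0 (x - ?d w)) * indicator B x \<partial>P) =
            (\<integral>\<^sup>+w. ennreal (m\<^sub>0 (x - ?d w)) \<partial>P) * indicator B x"
          by (rule nn_integral_multc) measurable
        moreover have "x - ?d w = x + c * (a * (t - t0)) - r * real (N t w)" for w by simp
        ultimately show "(\<integral>\<^sup>+w. ennreal (m\<^sub>0 (x - ?d w)) * indicator B x \<partial>P) = g t x * indicator B x"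
          by (simp only: g_def)
      qed
      also have "\<dots> = emeasure (density lborel (g t)) B"
        by (simp add: emeasure_density)
      finally show "emeasure (distr P lborel (X t)) B = emeasure (density lborel (g t)) B" .
    qed simp
    have "(\<integral>\<^sup>+x. g t x \<partial>lborel) = emeasure (distr P lborel (X t)) UNIV"
      unfolding distr by (simp add: emeasure_density)
    also have "\<dots> = 1"
      using emeasure_space_1 by (subst emeasure_distr) auto
    \<comment> \<open>The average of \<open>m\<^sub>0\<close> may be infinite on a null set, while
      the density has to be real-valued; \<open>enn2real\<close> changes it only there.\<close>
    finally have "AE x in lborel. g t x \<noteq> \<infinity>"
      by (intro nn_integral_PInf_AE) auto
    then have "density lborel (g t) = density lborel (\<lambda>x. ennreal (enn2real (g t x)))"
      by (intro density_cong) (auto elim!: eventually_mono simp: less_top)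
    with distr show ?thesis by (simp add: distributed_def)
  qed
  ultimately have "wealth_density K c r L t0 T m\<^sub>0 \<alpha> (\<lambda>t x. enn2real (g t x))"
    unfolding wealth_density_def by (intro conjI ballI allI exI[of _ P] exI[of _ F] exI[of _ N] exI[of _ X]) auto
  then show ?thesis by (rule that)
qed

text \<open>Total mass one turns the population mean of a rate that does not depend on wealth into
  that rate.\<close>

lemma wealth_density_integral:
  assumes "wealth_density K c r L t0 T m\<^sub>0 \<alpha> m" "t \<in> {t0..T}"
  shows "has_bochner_integral lborel (m t) 1"
proof -
  obtain P :: "sample measure" and F N X where
    P: "wealth_process K c r L t0 T \<alpha> P F N X" and X: "distributed P lborel (X t) (\<lambda>x. ennreal (m t x))"
    using assms unfolding wealth_density_def by blast
  have nonneg: "0 \<le> m t x" for x using assms by (simp add: wealth_density_def)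
  interpret prob_space P using P by (simp add: wealth_process_def has_intensity_def)
  have "(\<lambda>x. enn2real (ennreal (m t x))) \<in> borel_measurable lborel"
    using distributed_borel_measurable[OF X] by measurable
  then have [measurable]: "m t \<in> borel_measurable lborel"
    using nonneg by (simp add: enn2real_ennreal cong: measurable_cong)
  have "(\<integral>\<^sup>+x. ennreal (m t x) \<partial>lborel) = emeasure (distr P lborel (X t)) UNIV"
    unfolding distributed_distr_eq_density[OF X] by (simp add: emeasure_density)
  also have "\<dots> = 1"
    using emeasure_space_1 distributed_measurable[OF X] by (subst emeasure_distr) auto
  finally show ?thesis
    using nonneg by (intro has_bochner_integral_nn_integral) auto
qed

section \<open>Equilibrium\<close>

text \<open>A closed set containing almost every point of an open interval contains the whole
  interval; \<open>a < b\<close> then lets the closure reach the end points.\<close>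

lemma continuous_AE_const:
  fixes f :: "real \<Rightarrow> real"
  assumes cont: "continuous_on {a..b} f" and "a < b"
    and ae: "AE t in lborel. t \<in> {a..b} \<longrightarrow> f t = k" and t: "t \<in> {a..b}"
  shows "f t = k"
proof -
  let ?C = "{t \<in> {a..b}. f t = k}"
  have closed: "closed ?C" using cont by (rule continuous_closed_preimage_constant) simp
  have "AE t in lborel. t \<in> {a<..<b} \<longrightarrow> t \<in> ?C"
    using ae by eventually_elim auto
  then have "AE t \<in> {a<..<b} in lebesgue. t \<in> ?C"
    by (rule AE_completion)
  then have "{a<..<b} \<subseteq> ?C"
    using mem_closed_if_AE_lebesgue_open[OF open_greaterThanLessThan closed] by blast
  then have "closure {a<..<b} \<subseteq> ?C" using closed by (rule closure_minimal)
  then show ?thesis using t \<open>a < b\<close> by (auto simp: closure_greaterThanLessThan)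
qed

text \<open>
  With \<open>S = a + L\<close> the total hash rate, the first-order conditions of the two kinds of miners
  read \<open>S\<^sup>2 = L * \<kappa>\<close> and \<open>S\<^sup>2 = a * \<kappa>\<^sub>1\<close>, hence \<open>S = S\<^sup>2 / \<kappa> + S\<^sup>2 / \<kappa>\<^sub>1\<close>.
\<close>

locale equilibrium_constants =
  fixes \<kappa> \<kappa>\<^sub>1 :: real and M :: nat
  assumes \<kappa>_pos: "0 < \<kappa>" and M_less: "real M * \<kappa> < \<kappa>\<^sub>1"
begin

text \<open>The positive root of the equation for \<open>S\<close>, that is,
  \<open>1 / S = 1 / \<kappa> + 1 / \<kappa>\<^sub>1\<close>.\<close>

definition total_rate :: real where "total_rate = \<kappa> * \<kappa>\<^sub>1 / (\<kappa> + \<kappa>\<^sub>1)"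

lemma \<kappa>1_pos: "0 < \<kappa>\<^sub>1"
proof -
  have "0 \<le> real M * \<kappa>" using \<kappa>_pos by simp
  then show ?thesis using M_less by linarith
qed

lemma total_rate_bounds: "0 < total_rate" "total_rate < \<kappa>"
  using \<kappa>_pos \<kappa>1_pos by (simp_all add: total_rate_def field_simps)

lemma total_rate_eq: "total_rate\<^sup>2 / \<kappa> + total_rate\<^sup>2 / \<kappa>\<^sub>1 = total_rate"
proof -
  have "total_rate\<^sup>2 / \<kappa> + total_rate\<^sup>2 / \<kappa>\<^sub>1 = total_rate * (total_rate * (\<kappa> + \<kappa>\<^sub>1)) / (\<kappa> * \<kappa>\<^sub>1)"
    using \<kappa>_pos \<kappa>1_pos by (simp add: field_simps power2_eq_square)
  also have "total_rate * (\<kappa> + \<kappa>\<^sub>1) = \<kappa> * \<kappa>\<^sub>1"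
    using \<kappa>_pos \<kappa>1_pos by (simp add: total_rate_def)
  finally show ?thesis using \<kappa>_pos \<kappa>1_pos by simp
qed

lemma individual_rate_eq: "\<kappa>\<^sup>2 * \<kappa>\<^sub>1 / (\<kappa> + \<kappa>\<^sub>1)\<^sup>2 = total_rate\<^sup>2 / \<kappa>\<^sub>1"
  using \<kappa>1_pos by (simp add: total_rate_def power_divide power2_eq_square)

lemma advantaged_rate_eq:
  "\<kappa> * \<kappa>\<^sub>1 * (\<kappa>\<^sub>1 - real M * \<kappa>) / (\<kappa> + \<kappa>\<^sub>1)\<^sup>2 = total_rate\<^sup>2 / \<kappa> - real M * (total_rate\<^sup>2 / \<kappa>\<^sub>1)"
proof -
  have "total_rate\<^sup>2 / \<kappa> = \<kappa> * \<kappa>\<^sub>1 * \<kappa>\<^sub>1 / (\<kappa> + \<kappa>\<^sub>1)\<^sup>2"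
    using \<kappa>_pos by (simp add: total_rate_def power_divide power2_eq_square)
  then show ?thesis
    unfolding individual_rate_eq[symmetric]
    by (simp add: right_diff_distrib diff_divide_distrib power2_eq_square mult_ac)
qed

lemma individual_rate_pos: "0 < total_rate\<^sup>2 / \<kappa>\<^sub>1"
  using total_rate_bounds \<kappa>1_pos by simp

lemma advantaged_rate_pos: "0 < total_rate\<^sup>2 / \<kappa> - real M * (total_rate\<^sup>2 / \<kappa>\<^sub>1)"
  unfolding advantaged_rate_eq[symmetric] using \<kappa>_pos \<kappa>1_pos M_less by simp

lemma individual_fixed_point:
  "total_rate\<^sup>2 / \<kappa> < \<kappa>" "- (total_rate\<^sup>2 / \<kappa>) + sqrt (total_rate\<^sup>2 / \<kappa> * \<kappa>) = total_rate\<^sup>2 / \<kappa>\<^sub>1"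
proof -
  have "total_rate\<^sup>2 < \<kappa>\<^sup>2" using total_rate_bounds by (intro power_strict_mono) auto
  then show "total_rate\<^sup>2 / \<kappa> < \<kappa>" using \<kappa>_pos by (simp add: divide_less_eq power2_eq_square)
  show "- (total_rate\<^sup>2 / \<kappa>) + sqrt (total_rate\<^sup>2 / \<kappa> * \<kappa>) = total_rate\<^sup>2 / \<kappa>\<^sub>1"
    using \<kappa>_pos total_rate_bounds total_rate_eq by simp
qed

text \<open>\<open>\<kappa>\<^sub>1\<close> carries a factor \<open>M + 1\<close>, which cancels the
  number of rivals under the root.\<close>

lemma reply_eq: "reply (\<kappa>\<^sub>1 / (real M + 1)) ((real M + 1) * a) = max 0 (sqrt (a * \<kappa>\<^sub>1) - (real M + 1) * a)"
proof -
  have "(real M + 1) * a * (\<kappa>\<^sub>1 / (real M + 1)) = a * \<kappa>\<^sub>1" by (simp add: field_simps)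
  then show ?thesis by (simp only: reply_def)
qed

lemma reply_individual_rate:
  "reply (\<kappa>\<^sub>1 / (real M + 1)) ((real M + 1) * (total_rate\<^sup>2 / \<kappa>\<^sub>1)) =
    total_rate\<^sup>2 / \<kappa> - real M * (total_rate\<^sup>2 / \<kappa>\<^sub>1)"
proof -
  have "sqrt (total_rate\<^sup>2 / \<kappa>\<^sub>1 * \<kappa>\<^sub>1) = total_rate"
    using \<kappa>1_pos total_rate_bounds by simp
  moreover have "total_rate - (real M + 1) * (total_rate\<^sup>2 / \<kappa>\<^sub>1) = total_rate\<^sup>2 / \<kappa> - real M * (total_rate\<^sup>2 / \<kappa>\<^sub>1)"
    using total_rate_eq by (simp only: distrib_right)
  ultimately show ?thesis unfolding reply_eq using advantaged_rate_pos by simp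
qed

lemma competitors_unique:
  assumes a: "0 < a" and b: "b = reply (\<kappa>\<^sub>1 / (real M + 1)) ((real M + 1) * a)"
    and L: "L = real M * a + b" "a = - L + sqrt (L * \<kappa>)"
  shows "L = total_rate\<^sup>2 / \<kappa>"
proof -
  define S where "S = a + L"
  have b_nonneg: "0 \<le> b" unfolding b by (simp add: reply_def)
  then have L_nonneg: "0 \<le> L" using a L(1) by simp
  have S_sqrt: "S = sqrt (L * \<kappa>)" using L(2) by (simp add: S_def)
  have S: "0 < S" "S\<^sup>2 = L * \<kappa>"
    using a L_nonneg \<kappa>_pos by (simp add: S_def, simp add: S_sqrt)
  have S_eq: "S = (real M + 1) * a + b" using L(1) by (simp add: S_def distrib_right)
  have "S\<^sup>2 = a * \<kappa>\<^sub>1"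
  \<comment> \<open>In the corner \<open>b = 0\<close> one has \<open>L = M * a\<close> and \<open>a
    * \<kappa>\<^sub>1 \<le> S\<^sup>2 = L * \<kappa> = a * M * \<kappa>\<close>, against
    \<open>M * \<kappa> < \<kappa>\<^sub>1\<close>. Otherwise the first-order condition of the
    cost-advantaged miner holds with equality.\<close>
  proof (cases "b = 0")
    case True
    have "sqrt (a * \<kappa>\<^sub>1) \<le> S" using b True unfolding reply_eq by (simp add: S_eq)
    then have "(sqrt (a * \<kappa>\<^sub>1))\<^sup>2 \<le> S\<^sup>2" using a \<kappa>1_pos by (intro power_mono) auto
    then have "a * \<kappa>\<^sub>1 \<le> L * \<kappa>" using a \<kappa>1_pos S by simp
    moreover have "a * (real M * \<kappa>) < a * \<kappa>\<^sub>1" using a M_less by simp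
    ultimately have False using L(1) True by (simp add: mult_ac)
    then show ?thesis ..
  next
    case False
    then have "S = sqrt (a * \<kappa>\<^sub>1)" using b unfolding reply_eq by (simp add: S_eq max_def split: if_splits)
    then show ?thesis using a \<kappa>1_pos by simp
  qed
  then have "S\<^sup>2 / \<kappa>\<^sub>1 = a" using \<kappa>1_pos by simp
  moreover have "S\<^sup>2 / \<kappa> = L" using S(2) \<kappa>_pos by simp
  ultimately have "S = S\<^sup>2 / \<kappa>\<^sub>1 + S\<^sup>2 / \<kappa>" using S_def by linarith
  then have "S * (\<kappa> * \<kappa>\<^sub>1) = S * (S * (\<kappa> + \<kappa>\<^sub>1))"
    using \<kappa>_pos \<kappa>1_pos by (simp add: field_simps power2_eq_square)
  then have "S = total_rate"
    using S(1) \<kappa>_pos \<kappa>1_pos by (simp add: total_rate_def eq_divide_eq)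
  then show ?thesis using S(2) \<kappa>_pos by simp
qed

end

text \<open>The first implication is uniqueness. The second is existence, relative to the standing
  assumption on the value function: without it the first could speak about an empty class.
  Risk-neutrality is the case \<open>\<gamma> = 0\<close> or \<open>\<gamma>\<^sub>1 = 0\<close> of
  \<open>exp_utility\<close>.\<close>

theorem proposition4p1:
  fixes K c r k\<^sub>c c\<^sub>1 t0 T \<gamma> \<gamma>\<^sub>1 \<kappa> \<kappa>\<^sub>1 :: real
    and M :: nat
    and m\<^sub>0 \<alpha>b \<beta> :: "real \<Rightarrow> real"
  assumes "0 < K" and "0 < c" and "0 < r" and "1 \<le> M"
    and "0 < k\<^sub>c" and "k\<^sub>c \<le> 1" and "c\<^sub>1 = k\<^sub>c * c" and "t0 < T"
    and "\<forall>x. 0 \<le> m\<^sub>0 x" and "has_bochner_integral lborel m\<^sub>0 1"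
    and "m\<^sub>0 C1_differentiable_on UNIV"
    and "0 \<le> \<gamma>" and "0 \<le> \<gamma>\<^sub>1"
    and "k\<^sub>c < reward_weight r \<gamma>\<^sub>1 / reward_weight r \<gamma> * ((real M + 1) / real M)"
    and "\<kappa> = K * reward_weight r \<gamma> / c"
    and "\<kappa>\<^sub>1 = (real M + 1) * K * reward_weight r \<gamma>\<^sub>1 / c\<^sub>1"
    and "regular_value K c r M t0 T (exp_utility \<gamma>) \<alpha>b \<beta>"
  shows "(equilibrium K c c\<^sub>1 r M t0 T (exp_utility \<gamma>) (exp_utility \<gamma>\<^sub>1) m\<^sub>0 \<alpha>b \<beta> \<longrightarrow>
            (\<forall>t\<in>{t0..T}.
               (\<forall>x. optimal_hash_rate K c r T (exp_utility \<gamma>) (competitors M \<alpha>b \<beta>) t x = \<alpha>b t) \<and>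
               \<alpha>b t = \<kappa>\<^sup>2 * \<kappa>\<^sub>1 / (\<kappa> + \<kappa>\<^sub>1)\<^sup>2 \<and> 0 < \<alpha>b t \<and>
               \<beta> t = \<kappa> * \<kappa>\<^sub>1 * (\<kappa>\<^sub>1 - real M * \<kappa>) / (\<kappa> + \<kappa>\<^sub>1)\<^sup>2 \<and> 0 < \<beta> t)) \<and>
         ((\<forall>t\<in>{t0..T}. \<alpha>b t = \<kappa>\<^sup>2 * \<kappa>\<^sub>1 / (\<kappa> + \<kappa>\<^sub>1)\<^sup>2 \<and>
               \<beta> t = \<kappa> * \<kappa>\<^sub>1 * (\<kappa>\<^sub>1 - real M * \<kappa>) / (\<kappa> + \<kappa>\<^sub>1)\<^sup>2) \<longrightarrow>
            equilibrium K c c\<^sub>1 r M t0 T (exp_utility \<gamma>) (exp_utility \<gamma>\<^sub>1) m\<^sub>0 \<alpha>b \<beta>)"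
proof -
  define L where "L = competitors M \<alpha>b \<beta>"
  define rate where "rate = optimal_hash_rate K c r T (exp_utility \<gamma>) L"
  have L_eq: "L t = real M * \<alpha>b t + \<beta> t" for t by (simp add: L_def competitors_def)
  have w: "0 < reward_weight r \<gamma>" "0 < reward_weight r \<gamma>\<^sub>1"
    using reward_weight_pos assms by auto
  have c1: "0 < c\<^sub>1" using assms by simp
  have \<kappa>: "0 < \<kappa>" using assms w by simp
  have "real M * \<kappa> < \<kappa>\<^sub>1"
  \<comment> \<open>The bound on \<open>k\<^sub>c\<close>, cleared of denominators and multiplied by
    \<open>K / c\<^sub>1\<close> with \<open>c\<^sub>1 = k\<^sub>c * c\<close>, is exactly this
    inequality.\<close>
  proof -
    have "k\<^sub>c * (reward_weight r \<gamma> * real M) < reward_weight r \<gamma>\<^sub>1 * (real M + 1)"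
      using assms w by (simp add: pos_less_divide_eq)
    then have "K / c\<^sub>1 * (k\<^sub>c * (reward_weight r \<gamma> * real M)) < K / c\<^sub>1 * (reward_weight r \<gamma>\<^sub>1 * (real M + 1))"
      using assms c1 by (intro mult_strict_left_mono) auto
    moreover have "K / c\<^sub>1 * (k\<^sub>c * (reward_weight r \<gamma> * real M)) = real M * \<kappa>"
      using assms by simp
    moreover have "K / c\<^sub>1 * (reward_weight r \<gamma>\<^sub>1 * (real M + 1)) = \<kappa>\<^sub>1"
      using assms(16) by (simp add: mult_ac)
    ultimately show ?thesis by simp
  qed
  interpret equilibrium_constants \<kappa> \<kappa>\<^sub>1 M
    by unfold_locales (fact \<kappa>, fact)
  have regular: "classical_solution K c r t0 T (exp_utility \<gamma>) L (value_function K c r T (exp_utility \<gamma>) L)"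
      "\<And>t. t \<in> {t0..T} \<Longrightarrow> strict_mono (value_function K c r T (exp_utility \<gamma>) L t)"
    using assms(17) unfolding regular_value_def L_def Let_def by auto
  have miner: "individual_miner K c r \<gamma> t0 T L" if "\<And>t. t \<in> {t0..T} \<Longrightarrow> 0 \<le> L t"
    using that regular(2) assms by unfold_locales auto
  have threshold: "individual_miner.threshold K c r \<gamma> = \<kappa>" if "individual_miner K c r \<gamma> t0 T L"
    using individual_miner.threshold_def[OF that] assms(15) by simp
  have mining: "mining_cost K c\<^sub>1 r t0 T \<gamma>\<^sub>1 \<alpha>b"
    if "set_borel_measurable borel {t0..T} \<alpha>b" "\<And>t. t \<in> {t0..T} \<Longrightarrow> 0 < \<alpha>b t"
    using that assms c1 by unfold_locales auto
  have ratio: "mining_cost.ratio K c\<^sub>1 r \<gamma>\<^sub>1 = \<kappa>\<^sub>1 / (real M + 1)" if "mining_cost K c\<^sub>1 r t0 T \<gamma>\<^sub>1 \<alpha>b"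
  proof -
    have "\<kappa>\<^sub>1 = (real M + 1) * mining_cost.ratio K c\<^sub>1 r \<gamma>\<^sub>1"
      unfolding mining_cost.ratio_def[OF that] assms(16) by simp
    then show ?thesis by simp
  qed
  show ?thesis
  proof (intro conjI impI)
    assume eq: "equilibrium K c c\<^sub>1 r M t0 T (exp_utility \<gamma>) (exp_utility \<gamma>\<^sub>1) m\<^sub>0 \<alpha>b \<beta>"
    have alpha: "set_borel_measurable borel {t0..T} \<alpha>b" "\<And>t. t \<in> {t0..T} \<Longrightarrow> 0 < \<alpha>b t"
      and best: "best_response K c\<^sub>1 r M t0 T (exp_utility \<gamma>\<^sub>1) \<alpha>b \<beta>"
      using eq unfolding equilibrium_def by auto
    obtain m where m: "wealth_density K c r L t0 T m\<^sub>0 rate m"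
      and mean: "\<And>t. t \<in> {t0..T} \<Longrightarrow> \<alpha>b t = (\<integral>x. rate t x * m t x \<partial>lborel)"
      using eq unfolding equilibrium_def Let_def L_def[symmetric] rate_def[symmetric] by blast
    interpret A: mining_cost K c\<^sub>1 r t0 T \<gamma>\<^sub>1 M \<alpha>b by (rule mining) (use alpha in auto)
    have beta: "admissible_rate t0 T \<beta>"
      and reply: "AE t in lborel. t \<in> {t0..T} \<longrightarrow> \<beta> t = reply (\<kappa>\<^sub>1 / (real M + 1)) ((real M + 1) * \<alpha>b t)"
      using best unfolding A.best_response_iff ratio[OF A.mining_cost_axioms] by auto
    have L_pos: "0 < L t" if "t \<in> {t0..T}" for t
      using alpha(2)[OF that] beta that \<open>1 \<le> M\<close> unfolding L_eq admissible_rate_def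
      by (intro add_pos_nonneg) auto
    interpret I: individual_miner K c r \<gamma> t0 T L
      using miner L_pos less_imp_le by blast
    have rate_eq: "rate t x = (if L t < \<kappa> then - L t + sqrt (L t * \<kappa>) else 0)" if "t \<in> {t0..T}" for t x
      using I.optimal_hash_rate_eq[OF that] threshold[OF I.individual_miner_axioms] by (simp add: rate_def)
    have rate_alpha: "rate t x = \<alpha>b t" if t: "t \<in> {t0..T}" for t x
    proof -
      have "\<alpha>b t = (\<integral>z. rate t x * m t z \<partial>lborel)"
        unfolding mean[OF t] using rate_eq[OF t] by simp
      then show ?thesis
        using wealth_density_integral[OF m t] by (simp add: has_bochner_integral_iff)
    qed
    \<comment> \<open>The zero branch of the optimal rate contradicts
      \<open>0 < \<alpha>b t\<close>. These relations hold at every time, unlike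
      \<open>reply\<close>.\<close>
    have fixed: "L t < \<kappa>" "\<alpha>b t = - L t + sqrt (L t * \<kappa>)" if t: "t \<in> {t0..T}" for t
      using rate_alpha[OF t, of 0] rate_eq[OF t, of 0] alpha(2)[OF t] by (auto split: if_splits)
    have "continuous_on {t0..T} L"
      using I.competitors_continuous[OF regular(1)] L_pos fixed(1) threshold[OF I.individual_miner_axioms] by simp
    moreover have "AE t in lborel. t \<in> {t0..T} \<longrightarrow> L t = total_rate\<^sup>2 / \<kappa>"
      using reply
    proof eventually_elim
      case (elim t)
      then show ?case
        using competitors_unique[OF alpha(2) _ L_eq fixed(2)] by blast
    qed
    \<comment> \<open>Once \<open>L\<close> is known at every time, \<open>fixed\<close> yields
      \<open>\<alpha>b t\<close>, and \<open>\<beta> t\<close> follows by subtraction; the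
      almost-everywhere relation is not consulted again.\<close>
    ultimately have L: "L t = total_rate\<^sup>2 / \<kappa>" if "t \<in> {t0..T}" for t
      using continuous_AE_const \<open>t0 < T\<close> that by blast
    show "\<forall>t\<in>{t0..T}.
               (\<forall>x. optimal_hash_rate K c r T (exp_utility \<gamma>) (competitors M \<alpha>b \<beta>) t x = \<alpha>b t) \<and>
               \<alpha>b t = \<kappa>\<^sup>2 * \<kappa>\<^sub>1 / (\<kappa> + \<kappa>\<^sub>1)\<^sup>2 \<and> 0 < \<alpha>b t \<and>
               \<beta> t = \<kappa> * \<kappa>\<^sub>1 * (\<kappa>\<^sub>1 - real M * \<kappa>) / (\<kappa> + \<kappa>\<^sub>1)\<^sup>2 \<and> 0 < \<beta> t"
      unfolding individual_rate_eq advantaged_rate_eq L_def[symmetric] rate_def[symmetric]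
    proof
      fix t assume t: "t \<in> {t0..T}"
      have a: "\<alpha>b t = total_rate\<^sup>2 / \<kappa>\<^sub>1"
        using fixed(2)[OF t] individual_fixed_point(2) by (simp only: L[OF t])
      moreover have "\<beta> t = total_rate\<^sup>2 / \<kappa> - real M * (total_rate\<^sup>2 / \<kappa>\<^sub>1)"
        using L[OF t] by (simp add: L_eq a)
      ultimately show "(\<forall>x. rate t x = \<alpha>b t) \<and> \<alpha>b t = total_rate\<^sup>2 / \<kappa>\<^sub>1 \<and> 0 < \<alpha>b t \<and>
          \<beta> t = total_rate\<^sup>2 / \<kappa> - real M * (total_rate\<^sup>2 / \<kappa>\<^sub>1) \<and> 0 < \<beta> t"
        using rate_alpha[OF t] alpha(2)[OF t] advantaged_rate_pos by simp
    qed
  next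
    assume "\<forall>t\<in>{t0..T}. \<alpha>b t = \<kappa>\<^sup>2 * \<kappa>\<^sub>1 / (\<kappa> + \<kappa>\<^sub>1)\<^sup>2 \<and>
               \<beta> t = \<kappa> * \<kappa>\<^sub>1 * (\<kappa>\<^sub>1 - real M * \<kappa>) / (\<kappa> + \<kappa>\<^sub>1)\<^sup>2"
    then have alpha: "\<alpha>b t = total_rate\<^sup>2 / \<kappa>\<^sub>1"
      and beta: "\<beta> t = total_rate\<^sup>2 / \<kappa> - real M * (total_rate\<^sup>2 / \<kappa>\<^sub>1)" if "t \<in> {t0..T}" for t
      using that unfolding individual_rate_eq advantaged_rate_eq by auto
    have L: "L t = total_rate\<^sup>2 / \<kappa>" if "t \<in> {t0..T}" for t
      using that by (simp add: L_eq alpha beta)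
    have alpha_measurable: "set_borel_measurable borel {t0..T} \<alpha>b"
    proof -
      have "(\<lambda>t. indicator {t0..T} t *\<^sub>R \<alpha>b t) = (\<lambda>t. indicator {t0..T} t *\<^sub>R (total_rate\<^sup>2 / \<kappa>\<^sub>1))"
        by (auto simp: indicator_def alpha)
      then show ?thesis by (simp add: set_borel_measurable_def)
    qed
    interpret A: mining_cost K c\<^sub>1 r t0 T \<gamma>\<^sub>1 M \<alpha>b
      by (rule mining[OF alpha_measurable]) (use alpha individual_rate_pos in simp)
    have reply: "\<beta> t = reply A.ratio ((real M + 1) * \<alpha>b t)" if "t \<in> {t0..T}" for t
      unfolding ratio[OF A.mining_cost_axioms] alpha[OF that] beta[OF that] by (rule reply_individual_rate[symmetric])
    have "(\<lambda>t. indicator {t0..T} t *\<^sub>R \<beta> t) = (\<lambda>t. indicator {t0..T} t *\<^sub>R reply A.ratio ((real M + 1) * \<alpha>b t))"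
      by (auto simp: indicator_def reply)
    then have "admissible_rate t0 T \<beta>"
      using A.reply_admissible by (simp add: admissible_rate_def set_integrable_def reply)
    then have best: "best_response K c\<^sub>1 r M t0 T (exp_utility \<gamma>\<^sub>1) \<alpha>b \<beta>"
      unfolding A.best_response_iff using reply by simp
    interpret I: individual_miner K c r \<gamma> t0 T L
      by (rule miner) (use L \<kappa> in simp)
    have rate: "rate t x = total_rate\<^sup>2 / \<kappa>\<^sub>1" if "t \<in> {t0..T}" for t x
      using I.optimal_hash_rate_eq[OF that] individual_fixed_point threshold[OF I.individual_miner_axioms]
      by (simp add: rate_def L[OF that])
    \<comment> \<open>On the interval all rates are constant, so the success rate of each individual
      miner is a constant and the explicit wealth process applies.\<close>
    obtain m where m: "wealth_density K c r L t0 T m\<^sub>0 rate m"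
    proof (rule wealth_density_exists[of m\<^sub>0 t0 T "total_rate\<^sup>2 / \<kappa>\<^sub>1" rate
        "K * (total_rate\<^sup>2 / \<kappa>\<^sub>1) / (total_rate\<^sup>2 / \<kappa>\<^sub>1 + total_rate\<^sup>2 / \<kappa>)" K L])
      show "0 \<le> K * (total_rate\<^sup>2 / \<kappa>\<^sub>1) / (total_rate\<^sup>2 / \<kappa>\<^sub>1 + total_rate\<^sup>2 / \<kappa>)"
        using assms(1) \<kappa> \<kappa>1_pos by (intro divide_nonneg_nonneg mult_nonneg_nonneg add_nonneg_nonneg) auto
    qed (use assms individual_rate_pos rate L in \<open>auto simp: less_imp_le\<close>)
    have "integrable lborel (\<lambda>x. rate t x * m t x) \<and> \<alpha>b t = (\<integral>x. rate t x * m t x \<partial>lborel)"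
      if t: "t \<in> {t0..T}" for t
      using wealth_density_integral[OF m t] by (simp add: rate[OF t] alpha[OF t] has_bochner_integral_iff)
    then show "equilibrium K c c\<^sub>1 r M t0 T (exp_utility \<gamma>) (exp_utility \<gamma>\<^sub>1) m\<^sub>0 \<alpha>b \<beta>"
      unfolding equilibrium_def Let_def L_def[symmetric] rate_def[symmetric]
      using alpha_measurable A.alpha_pos best m by blast
  qed
qed

end
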